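(* Let $a\in(0,1)$, $n\ge 2$, and $P(z) = (z-a)\prod_{j=1}^{n-1}(z-z_j)$ with $|z_j| \leq 1$ for all $j = 1, \ldots , n-1$. Define $\gamma(a) = 0.1a+0.9$, $c = a\gamma(a)$, $p' = \frac{a/4}{1-a/2}$, $q' = \frac{a/4}{1+a/2}$, $r = \frac{c(a-c)}{2(1-c^2)}$, $\alpha = \frac{\log ( a/16 )}{\log \left( \frac{c+r}{1+cr} \right)}$, $$K' = \min \left\{ (1+c-ac)^{p'} \left(\sqrt{1+c^2-ac}\right)^{1-p'},\ (1+c)^{q'} \left(\sqrt{1+c^2-ac}\right)^{1-q'} \right\},$$ $\mathcal{N}_0(a) = \frac{32 \log ( 40/a^2 )}{a^2}$, $\mathcal{N}_1(a) = \max \left \{ 9 \left( \frac{4+2a}{a} \right)^2 , \mathcal{N}_0(a) \right \}$, $\mathcal{N}_2(a,c) = \max \left \{ 9 \left( \frac{\log ( a/16 )}{\log \left( \frac{c}{1+a} \right) } \right)^2 , \mathcal{N}_0(a) \right \}$, and $$\mathcal{N}_3(a) = \max\left\{\mathcal{N}_0(a),\ \frac{\log \left( \frac{1+a}{a-c} \right) + \log \left( \frac{1-ac}{1-c} \right) - \alpha \log(r)}{\log (K')} + 1\right\}.$$ If $n > \max \{ \mathcal{N}_1(a), \mathcal{N}_2(a, c), \mathcal{N}_3(a) \}$, then $P'$ has a zero in the closed disk $\{z : |z-a|\leq 1\}$. *)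

theory Defs
  imports "HOL-Analysis.Analysis" "HOL-Computational_Algebra.Polynomial"
begin

definition gam :: "real \<Rightarrow> real" where "gam a = 0.1 * a + 0.9"
definition cc :: "real \<Rightarrow> real" where "cc a = a * gam a"
definition pp :: "real \<Rightarrow> real" where "pp a = (a/4) / (1 - a/2)"
definition qq :: "real \<Rightarrow> real" where "qq a = (a/4) / (1 + a/2)"
definition rr :: "real \<Rightarrow> real" where
  "rr a = cc a * (a - cc a) / (2 * (1 - (cc a)^2))"
definition alpha :: "real \<Rightarrow> real" where
  "alpha a = ln (a/16) / ln ((cc a + rr a) / (1 + cc a * rr a))"
definition KK :: "real \<Rightarrow> real" where
  "KK a = (let c = cc a; s = sqrt (1 + c^2 - a*c) in
     min ((1 + c - a*c) powr (pp a) * s powr (1 - pp a))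
         ((1 + c) powr (qq a) * s powr (1 - qq a)))"
definition N0 :: "real \<Rightarrow> real" where "N0 a = 32 * ln (40 / a^2) / a^2"
definition N1 :: "real \<Rightarrow> real" where "N1 a = max (9 * ((4 + 2*a)/a)^2) (N0 a)"
definition N2 :: "real \<Rightarrow> real \<Rightarrow> real" where
  "N2 a c = max (9 * (ln (a/16) / ln (c / (1 + a)))^2) (N0 a)"
definition N3 :: "real \<Rightarrow> real" where
  "N3 a = (let c = cc a in max (N0 a)
     ((ln ((1 + a)/(a - c)) + ln ((1 - a*c)/(1 - c)) - alpha a * ln (rr a)) / ln (KK a) + 1))"

end

theory Submission
  imports Defs "HOL-Computational_Algebra.Fundamental_Theorem_Algebra"
begin

text \<open>
  Suppose that all critical points \<open>w\<close> of \<open>P\<close> satisfy \<open>\<bar>w - a\<bar> > 1\<close>; by Gauss--Lucas they lie in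
  the lune \<open>\<bar>w\<bar> \<le> 1 < \<bar>w - a\<bar>\<close>. Write \<open>P x = P' a * (x - a) * (\<integral>s\<in>[0,1]. \<Prod>j. 1 + s * v j)\<close> with
  \<open>v j = (x - a) / (a - w j)\<close>. Walsh's coincidence theorem replaces the \<open>v j\<close> by a single
  \<open>y - 1\<close> in any disc around \<open>- 1\<close> that contains them, which turns the integral into
  \<open>(1 + y + \<dots> + y ^ (n - 1)) / n\<close>. For real \<open>x\<close> between 0 and \<open>a\<close> this bounds \<open>\<bar>P x\<bar>\<close> from both
  sides, and it shows that \<open>P\<close> has no zero near \<open>c\<close>. The lower bound at \<open>a / 4\<close> forces the mean
  real part of the zeros, hence of the critical points, to be at most \<open>a / 4\<close>; then \<open>P'\<close> is tiny
  on \<open>[0, a / 2]\<close>, so that \<open>P 0\<close> is not small and the other zeros have product of modulus at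
  least \<open>1 / 10\<close>.

  Finally compare \<open>\<Prod>j. \<bar>1 - c * w j\<bar>\<close>, which is at least \<open>K' ^ (n - 1)\<close> by concavity of the
  logarithm, with \<open>\<Prod>k. \<bar>1 - c * z k\<bar>\<close>, which is \<open>\<bar>P c\<bar>\<close> divided by the Blaschke product of the
  zeros at \<open>c\<close>. Each factor of the latter is at least \<open>\<bar>z k\<bar> powr \<kappa>\<close>, so the product stays
  bounded, which contradicts \<open>K' > 1\<close> once \<open>n\<close> is large.
\<close>

section \<open>Polynomials given by their roots\<close>

definition poly_of_roots :: "nat \<Rightarrow> (nat \<Rightarrow> 'a :: comm_ring_1) \<Rightarrow> 'a poly" where
  "poly_of_roots n z = (\<Prod>k<n. [:- z k, 1:])"

lemma poly_poly_of_roots: "poly (poly_of_roots n z) x = (\<Prod>k<n. x - z k)"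
  by (simp add: poly_of_roots_def poly_prod)

lemma poly_poly_of_roots_eq_0_iff:
  fixes z :: "nat \<Rightarrow> 'a :: idom"
  shows "poly (poly_of_roots n z) x = 0 \<longleftrightarrow> (\<exists>k<n. x = z k)"
  by (auto simp: poly_poly_of_roots)

lemma cmod_poly_of_roots: "cmod (poly (poly_of_roots n z) x) = (\<Prod>k<n. cmod (x - z k))"
  by (simp add: poly_poly_of_roots prod_norm)

lemma degree_poly_of_roots:
  fixes z :: "nat \<Rightarrow> 'a :: idom"
  shows "degree (poly_of_roots n z) = n"
  unfolding poly_of_roots_def by (subst degree_prod_eq_sum_degree) auto

lemma coeff_poly_of_roots_degree:
  fixes z :: "nat \<Rightarrow> 'a :: idom"
  shows "coeff (poly_of_roots n z) n = 1"
  using lead_coeff_prod[of "\<lambda>k. [:- z k, 1:]" "{..<n}"] degree_poly_of_roots[of n z]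
  by (simp add: poly_of_roots_def)

lemma coeff_poly_of_roots_subleading:
  fixes z :: "nat \<Rightarrow> 'a :: idom"
  shows "coeff (poly_of_roots (Suc n) z) n = - (\<Sum>k<Suc n. z k)"
proof (induction n)
  case 0
  show ?case by (simp add: poly_of_roots_def)
next
  case (Suc n)
  have "poly_of_roots (Suc (Suc n)) z = [:- z (Suc n), 1:] * poly_of_roots (Suc n) z"
    unfolding poly_of_roots_def by (subst prod.lessThan_Suc) (rule mult.commute)
  then have "coeff (poly_of_roots (Suc (Suc n)) z) (Suc n)
      = coeff (poly_of_roots (Suc n) z) n - z (Suc n) * coeff (poly_of_roots (Suc n) z) (Suc n)"
    by simp
  then show ?case
    unfolding Suc.IH coeff_poly_of_roots_degree by simp
qed

lemma complex_poly_eq_poly_of_roots: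
  fixes p :: "complex poly"
  obtains w where "p = smult (lead_coeff p) (poly_of_roots (degree p) w)"
  using complex_poly_decompose'[of p] unfolding poly_of_roots_def by metis

lemma pderiv_poly_of_roots_eq:
  fixes z :: "nat \<Rightarrow> complex"
  obtains w where "pderiv (poly_of_roots (Suc m) z) = smult (of_nat (Suc m)) (poly_of_roots m w)"
proof -
  have deg: "degree (pderiv (poly_of_roots (Suc m) z)) = m"
    by (simp add: degree_pderiv degree_poly_of_roots)
  then have "lead_coeff (pderiv (poly_of_roots (Suc m) z)) = of_nat (Suc m)"
    by (simp only: coeff_pderiv coeff_poly_of_roots_degree mult_1_right)
  with deg show thesis
    by (metis complex_poly_eq_poly_of_roots that)
qed

lemma sum_roots_pderiv:
  fixes z w :: "nat \<Rightarrow> 'a :: idom"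
  assumes "pderiv (poly_of_roots (Suc m) z) = smult (of_nat (Suc m)) (poly_of_roots m w)"
  shows "of_nat (Suc m) * (\<Sum>j<m. w j) = of_nat m * (\<Sum>k<Suc m. z k)"
proof (cases m)
  case (Suc l)
  have "coeff (pderiv (poly_of_roots (Suc m) z)) l = - (of_nat m * (\<Sum>k<Suc m. z k))"
    unfolding coeff_pderiv Suc coeff_poly_of_roots_subleading by (simp only: mult_minus_right)
  moreover have "coeff (pderiv (poly_of_roots (Suc m) z)) l = - (of_nat (Suc m) * (\<Sum>j<m. w j))"
    unfolding assms coeff_smult unfolding Suc coeff_poly_of_roots_subleading
    by (simp only: mult_minus_right)
  ultimately show ?thesis by simp
qed simp

lemma poly_pderiv_poly_of_roots:
  fixes z :: "nat \<Rightarrow> 'a :: field"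
  assumes "\<And>k. k < n \<Longrightarrow> x \<noteq> z k"
  shows "poly (pderiv (poly_of_roots n z)) x
    = poly (poly_of_roots n z) x * (\<Sum>k<n. 1 / (x - z k))"
proof -
  have "poly (pderiv (poly_of_roots n z)) x = (\<Sum>k<n. \<Prod>i\<in>{..<n} - {k}. x - z i)"
    by (simp add: poly_of_roots_def pderiv_prod pderiv_pCons poly_sum poly_prod)
  also have "\<dots> = (\<Sum>k<n. (\<Prod>i<n. x - z i) / (x - z k))"
    using assms by (intro sum.cong refl) (simp add: prod.remove[of "{..<n}"])
  finally show ?thesis
    by (simp add: poly_poly_of_roots sum_distrib_left)
qed

lemma prod_one_minus_mult_eq:
  fixes c :: "'a :: field"
  assumes "c \<noteq> 0"
  shows "(\<Prod>k<n. 1 - c * z k) = c ^ n * poly (poly_of_roots n z) (1 / c)"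
proof -
  have "c ^ n * (\<Prod>k<n. 1 / c - z k) = (\<Prod>k<n. c * (1 / c - z k))"
    by (simp add: prod.distrib)
  also have "\<dots> = (\<Prod>k<n. 1 - c * z k)"
    using assms by (simp add: right_diff_distrib)
  finally show ?thesis by (simp add: poly_poly_of_roots)
qed

lemma prod_reflected_pderiv:
  fixes c :: "'a :: field"
  assumes pderiv: "pderiv (poly_of_roots (Suc m) z) = smult (of_nat (Suc m)) (poly_of_roots m w)"
    and "c \<noteq> 0" and ne: "\<And>k. k < Suc m \<Longrightarrow> c * z k \<noteq> 1"
  shows "of_nat (Suc m) * (\<Prod>j<m. 1 - c * w j)
    = (\<Prod>k<Suc m. 1 - c * z k) * (\<Sum>k<Suc m. 1 / (1 - c * z k))"
proof -
  have "1 / c \<noteq> z k" if "k < Suc m" for k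
    using ne[OF that] \<open>c \<noteq> 0\<close> by (auto simp: field_simps)
  then have "of_nat (Suc m) * poly (poly_of_roots m w) (1 / c)
      = poly (poly_of_roots (Suc m) z) (1 / c) * (\<Sum>k<Suc m. 1 / (1 / c - z k))"
    unfolding poly_smult[symmetric] pderiv[symmetric] by (rule poly_pderiv_poly_of_roots)
  also have "(\<Sum>k<Suc m. 1 / (1 / c - z k)) = c * (\<Sum>k<Suc m. 1 / (1 - c * z k))"
    unfolding sum_distrib_left using \<open>c \<noteq> 0\<close> by (intro sum.cong refl) (simp add: field_simps)
  finally show ?thesis
    unfolding prod_one_minus_mult_eq[OF \<open>c \<noteq> 0\<close>]
    by (simp add: mult_ac del: sum.lessThan_Suc of_nat_Suc)
qed

theorem gauss_lucas:
  fixes p :: "complex poly"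
  assumes "pderiv p \<noteq> 0" and w: "poly (pderiv p) w = 0"
  shows "w \<in> convex hull {z. poly p z = 0}"
proof (cases "poly p w = 0")
  case True
  then show ?thesis by (simp add: hull_inc)
next
  case False
  obtain z where z: "p = smult (lead_coeff p) (poly_of_roots (degree p) z)"
    by (rule complex_poly_eq_poly_of_roots)
  define n where "n = degree p"
  have "p \<noteq> 0" "0 < n" using assms(1) by (auto simp: n_def pderiv_eq_0_iff)
  have root: "poly p (z k) = 0" if "k < n" for k
    by (subst z) (use that in \<open>auto simp: poly_poly_of_roots_eq_0_iff n_def\<close>)
  have w_ne_z: "w \<noteq> z k" if "k < n" for k using root[OF that] False by auto
  have "lead_coeff p * (poly (poly_of_roots n z) w * (\<Sum>k<n. 1 / (w - z k))) = 0"
    using w poly_pderiv_poly_of_roots[of n w z] w_ne_z z by (metis n_def pderiv_smult poly_smult)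
  moreover have "poly (poly_of_roots n z) w \<noteq> 0"
    using w_ne_z by (auto simp: poly_poly_of_roots_eq_0_iff)
  ultimately have "(\<Sum>k<n. 1 / (w - z k)) = 0" using \<open>p \<noteq> 0\<close> by simp
  moreover define c where "c k = 1 / (cmod (w - z k))\<^sup>2" for k
  have "1 / (w - z k) = cnj (c k *\<^sub>R (w - z k))" for k
    using complex_div_cnj[of 1 "w - z k"] by (simp add: c_def scaleR_conv_of_real)
  ultimately have "cnj (\<Sum>k<n. c k *\<^sub>R (w - z k)) = 0" by simp
  then have "(\<Sum>k<n. c k *\<^sub>R (w - z k)) = 0" by (simp only: complex_cnj_zero_iff)
  then have balance: "(\<Sum>k<n. c k *\<^sub>R z k) = (\<Sum>k<n. c k) *\<^sub>R w"
    by (simp add: scaleR_diff_right sum_subtractf scaleR_sum_left)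
  have c_nonneg: "0 \<le> c k" for k by (simp add: c_def)
  have c_pos: "0 < (\<Sum>k<n. c k)"
    using w_ne_z \<open>0 < n\<close> by (intro sum_pos) (auto simp: c_def)
  have "(\<Sum>k<n. (c k / (\<Sum>k<n. c k)) *\<^sub>R z k) \<in> convex hull {z. poly p z = 0}"
    using c_pos root
    by (intro convex_sum convex_convex_hull)
      (auto simp: c_nonneg hull_inc simp flip: sum_divide_distrib)
  also have "(\<Sum>k<n. (c k / (\<Sum>k<n. c k)) *\<^sub>R z k) = inverse (\<Sum>k<n. c k) *\<^sub>R (\<Sum>k<n. c k *\<^sub>R z k)"
    by (simp add: scaleR_sum_right divide_inverse_commute)
  also have "\<dots> = w" using c_pos by (simp add: balance)
  finally show ?thesis .
qed

section \<open>Polar derivatives and Walsh's coincidence theorem\<close>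

lemma outside_disc_reciprocal_eq_cball:
  fixes z :: complex and T :: real
  assumes "cmod z < T"
  defines "\<alpha> \<equiv> T\<^sup>2 - (cmod z)\<^sup>2"
  shows "{t. T * cmod t \<le> cmod (z * t - 1)} = cball (- cnj z / of_real \<alpha>) (T / \<alpha>)"
proof (rule set_eqI)
  fix t
  have "0 < T" using assms(1) norm_ge_zero[of z] by linarith
  have "0 < \<alpha>" unfolding \<alpha>_def using assms(1) by (simp add: power_strict_mono)
  have "(cmod (of_real \<alpha> * t + cnj z))\<^sup>2 - T\<^sup>2 = \<alpha> * ((T * cmod t)\<^sup>2 - (cmod (z * t - 1))\<^sup>2)"
    unfolding \<alpha>_def cmod_power2 power_mult_distrib
    by (simp add: power2_eq_square algebra_simps)
  then have "cmod (of_real \<alpha> * t + cnj z) \<le> T \<longleftrightarrow> T * cmod t \<le> cmod (z * t - 1)"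
    using \<open>0 < T\<close> \<open>0 < \<alpha>\<close> abs_le_square_iff[of "cmod (of_real \<alpha> * t + cnj z)" T]
      abs_le_square_iff[of "T * cmod t" "cmod (z * t - 1)"]
    by (smt (verit) mult_le_0_iff mult_nonneg_nonneg norm_ge_zero)
  moreover have "dist (- cnj z / of_real \<alpha>) t = cmod (of_real \<alpha> * t + cnj z) / \<alpha>"
  proof -
    have "- cnj z / of_real \<alpha> - t = - ((of_real \<alpha> * t + cnj z) / of_real \<alpha>)"
      using \<open>0 < \<alpha>\<close> by (simp add: field_simps)
    then show ?thesis using \<open>0 < \<alpha>\<close> by (simp only: dist_norm norm_minus_cancel norm_divide) simp
  qed
  ultimately show "t \<in> {t. T * cmod t \<le> cmod (z * t - 1)}
      \<longleftrightarrow> t \<in> cball (- cnj z / of_real \<alpha>) (T / \<alpha>)"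
    using \<open>0 < \<alpha>\<close> by (simp add: divide_le_cancel)
qed

text \<open>Zeros at infinity are added to make up the degree \<open>N\<close>; then \<open>t\<close> is the mean of the
  \<open>1 / (z - w)\<close> over the zeros \<open>w\<close>, which all lie in the same convex set.\<close>

lemma pderiv_eq_mean_reciprocal:
  fixes p :: "complex poly"
  assumes "degree p \<le> N" "0 < N"
    and nz: "\<And>x. x \<in> ball c T \<Longrightarrow> poly p x \<noteq> 0" and z: "z \<in> ball c T"
  obtains t where "T * cmod t \<le> cmod ((z - c) * t - 1)"
    "poly (pderiv p) z = of_nat N * t * poly p z"
proof -
  obtain w where w: "p = smult (lead_coeff p) (poly_of_roots (degree p) w)"
    by (rule complex_poly_eq_poly_of_roots)
  have root: "poly p (w j) = 0" if "j < degree p" for j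
    by (subst w) (use that in \<open>auto simp: poly_poly_of_roots_eq_0_iff\<close>)
  have w_far: "T \<le> cmod (w j - c)" if "j < degree p" for j
    using nz[of "w j"] root[OF that] by (force simp: dist_norm norm_minus_commute)
  have z_ne_w: "z \<noteq> w j" if "j < degree p" for j
    using root[OF that] nz[OF z] by auto
  define t where "t j = (if j < degree p then 1 / (z - w j) else 0)" for j
  let ?mean = "\<Sum>j<N. (1 / real N) *\<^sub>R t j"
  have "poly (pderiv p) z = poly p z * (\<Sum>j<degree p. 1 / (z - w j))"
    using poly_pderiv_poly_of_roots[of "degree p" z w, OF z_ne_w]
    by (metis w pderiv_smult poly_smult mult.assoc)
  also have "(\<Sum>j<degree p. 1 / (z - w j)) = (\<Sum>j<N. t j)"
    using assms(1) by (intro sum.mono_neutral_cong_left) (auto simp: t_def)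
  also have "\<dots> = of_nat N * ?mean"
    using \<open>0 < N\<close> by (simp add: scaleR_conv_of_real flip: sum_divide_distrib)
  finally have pderiv: "poly (pderiv p) z = of_nat N * ?mean * poly p z"
    by (simp only: mult.commute)
  let ?S = "{t. T * cmod t \<le> cmod ((z - c) * t - 1)}"
  have "cmod (z - c) < T" using z by (simp add: dist_norm norm_minus_commute)
  then have "convex ?S" by (simp add: outside_disc_reciprocal_eq_cball)
  moreover have "t j \<in> ?S" for j
  proof (cases "j < degree p")
    case True
    then have "(z - c) * t j - 1 = (w j - c) * t j"
      using z_ne_w[OF True] by (simp add: t_def field_simps)
    then show ?thesis using w_far[OF True] by (simp add: norm_mult mult_right_mono)
  qed (simp add: t_def)
  ultimately have "?mean \<in> ?S" using \<open>0 < N\<close> by (intro convex_sum) auto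
  with pderiv show thesis by (intro that[of ?mean]) simp_all
qed

lemma laguerre_polar_derivative:
  fixes p :: "complex poly"
  assumes "degree p \<le> N" "0 < N"
    and nz: "\<And>x. x \<in> ball c T \<Longrightarrow> poly p x \<noteq> 0"
    and u: "u \<in> ball c T" and z: "z \<in> ball c T"
  shows "of_nat N * poly p z + (u - z) * poly (pderiv p) z \<noteq> 0"
proof
  assume polar: "of_nat N * poly p z + (u - z) * poly (pderiv p) z = 0"
  obtain t where t: "T * cmod t \<le> cmod ((z - c) * t - 1)"
    and pderiv: "poly (pderiv p) z = of_nat N * t * poly p z"
    by (rule pderiv_eq_mean_reciprocal[OF assms(1,2) nz z])
  from polar have "of_nat N * poly p z * (1 - (z - u) * t) = 0"
    unfolding pderiv by (simp add: algebra_simps)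
  then have mean: "(z - u) * t = 1" using nz[OF z] \<open>0 < N\<close> by simp
  then have "(z - c) * t - 1 = (u - c) * t" by (simp add: algebra_simps)
  then have "T * cmod t \<le> cmod (u - c) * cmod t" using t by (simp add: norm_mult)
  moreover have "0 < cmod t" using mean by auto
  ultimately show False using u by (simp add: dist_norm norm_minus_commute)
qed

lemma linear_functional_polyI:
  fixes L :: "'a :: comm_ring_1 poly \<Rightarrow> 'a"
  assumes "\<And>p q. L (p + q) = L p + L q" "\<And>c p. L (smult c p) = c * L p"
  shows "module_hom smult (*) L"
  by unfold_locales (simp_all add: assms smult_add_left smult_add_right distrib_left distrib_right)

lemma linear_functional_mult_left:
  assumes "module_hom smult (*) L"
  shows "module_hom smult (*) (\<lambda>p. L (q * p))"
  using assms
  by (intro linear_functional_polyI) (simp_all add: distrib_left module_hom.add module_hom.scale)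

definition symbol_poly :: "('a :: comm_ring_1 poly \<Rightarrow> 'a) \<Rightarrow> nat \<Rightarrow> 'a poly" where
  "symbol_poly L N = (\<Sum>k\<le>N. monom (of_nat (N choose k) * L (monom 1 k)) k)"

lemma degree_symbol_poly: "degree (symbol_poly L N) \<le> N"
  unfolding symbol_poly_def
  by (intro degree_sum_le) (auto intro: order_trans[OF degree_monom_le])

lemma poly_symbol_poly:
  assumes "module_hom smult (*) L"
  shows "poly (symbol_poly L N) z = L ([:1, z:] ^ N)"
proof -
  interpret L: module_hom smult "(*)" L by fact
  have "[:1, z:] ^ N = (\<Sum>k\<le>N. monom (of_nat (N choose k) * z ^ k) k)"
  proof (rule poly_eqI)
    fix i
    have "degree ([:1, z:] ^ N) \<le> 1 * N"
      by (intro order_trans[OF degree_power_le] mult_right_mono) simp_all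
    then show "coeff ([:1, z:] ^ N) i = coeff (\<Sum>k\<le>N. monom (of_nat (N choose k) * z ^ k) k) i"
      by (cases "i \<le> N") (simp_all add: coeff_linear_poly_power coeff_sum coeff_eq_0)
  qed
  also have "\<dots> = (\<Sum>k\<le>N. smult (of_nat (N choose k) * z ^ k) (monom 1 k))"
    by (simp add: smult_monom)
  finally have "L ([:1, z:] ^ N) = (\<Sum>k\<le>N. of_nat (N choose k) * z ^ k * L (monom 1 k))"
    by (simp only: L.sum L.scale)
  then show ?thesis
    unfolding symbol_poly_def poly_sum poly_monom
    by (simp only: mult.assoc mult.commute[of _ "z ^ _"])
qed

lemma pderiv_symbol_poly:
  "pderiv (symbol_poly L (Suc N)) = smult (of_nat (Suc N)) (symbol_poly (\<lambda>p. L (pCons 0 p)) N)"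
proof -
  have absorb: "of_nat (Suc k) * of_nat (Suc N choose Suc k)
      = (of_nat (Suc N) * of_nat (N choose k) :: 'a)" for k
    using Suc_times_binomial_eq[of N k] by (metis mult.commute of_nat_mult)
  show ?thesis
  proof (rule poly_eqI)
    fix i
    show "coeff (pderiv (symbol_poly L (Suc N))) i
      = coeff (smult (of_nat (Suc N)) (symbol_poly (\<lambda>p. L (pCons 0 p)) N)) i"
      by (simp add: symbol_poly_def coeff_pderiv coeff_sum monom_Suc absorb flip: mult.assoc
          del: of_nat_Suc binomial_Suc_Suc)
  qed
qed

lemma polar_derivative_symbol_poly:
  assumes "module_hom smult (*) L"
  shows "of_nat (Suc N) * poly (symbol_poly L (Suc N)) z
      + (u - z) * poly (pderiv (symbol_poly L (Suc N))) z
    = of_nat (Suc N) * L ([:1, u:] * [:1, z:] ^ N)"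
proof -
  interpret L: module_hom smult "(*)" L by fact
  have "module_hom smult (*) (\<lambda>p. L (pCons 0 p))"
    using linear_functional_mult_left[OF assms, of "[:0, 1:]"] by simp
  then have "poly (pderiv (symbol_poly L (Suc N))) z
      = of_nat (Suc N) * L (pCons 0 ([:1, z:] ^ N))"
    by (simp add: pderiv_symbol_poly poly_symbol_poly del: of_nat_Suc)
  moreover have "L ([:1, u:] * [:1, z:] ^ N)
      = L ([:1, z:] ^ Suc N) + (u - z) * L (pCons 0 ([:1, z:] ^ N))"
    unfolding L.scale[symmetric] L.add[symmetric] by (simp add: smult_diff_left add.assoc)
  ultimately show ?thesis
    unfolding poly_symbol_poly[OF assms] by (simp only: distrib_left mult.left_commute)
qed

text \<open>Every symmetric multiaffine form in \<open>u 0, \<dots>, u (N - 1)\<close> is \<open>L (\<Prod>j<N. 1 + u j X)\<close> for a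
  linear functional \<open>L\<close> on polynomials.\<close>

theorem grace_linear_functional:
  fixes L :: "complex poly \<Rightarrow> complex"
  assumes "module_hom smult (*) L" and "0 < T"
    and "\<And>z. z \<in> ball c T \<Longrightarrow> L ([:1, z:] ^ N) \<noteq> 0"
    and "\<And>j. j < N \<Longrightarrow> u j \<in> ball c T"
  shows "L (\<Prod>j<N. [:1, u j:]) \<noteq> 0"
  using assms
proof (induction N arbitrary: L)
  case 0
  from "0.prems"(3)[of c] \<open>0 < T\<close> show ?case by simp
next
  case (Suc N)
  have "L ([:1, u N:] * [:1, z:] ^ N) \<noteq> 0" if z: "z \<in> ball c T" for z
  proof -
    have "of_nat (Suc N) * L ([:1, u N:] * [:1, z:] ^ N) \<noteq> 0"
      unfolding polar_derivative_symbol_poly[OF Suc.prems(1), symmetric]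
    proof (rule laguerre_polar_derivative[OF degree_symbol_poly])
      show "poly (symbol_poly L (Suc N)) x \<noteq> 0" if "x \<in> ball c T" for x
        unfolding poly_symbol_poly[OF Suc.prems(1)] using that by (rule Suc.prems(3))
    qed (use z Suc.prems(4) in auto)
    then show ?thesis by simp
  qed
  then have "L ([:1, u N:] * (\<Prod>j<N. [:1, u j:])) \<noteq> 0"
    using Suc.prems(2,4)
    by (intro Suc.IH[of "\<lambda>p. L ([:1, u N:] * p)"] linear_functional_mult_left Suc.prems(1))
      simp_all
  then show ?case by (simp add: mult.commute)
qed

theorem walsh_coincidence:
  fixes L :: "complex poly \<Rightarrow> complex"
  assumes "module_hom smult (*) L" and "0 < T"
    and u: "\<And>j. j < N \<Longrightarrow> u j \<in> ball c T"
  obtains y where "y \<in> ball c T" "L (\<Prod>j<N. [:1, u j:]) = L ([:1, y:] ^ N)"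
proof (rule ccontr)
  interpret L: module_hom smult "(*)" L by fact
  let ?v = "L (\<Prod>j<N. [:1, u j:])"
  let ?M = "\<lambda>p. L p - ?v * poly p 0"
  assume "\<not> thesis"
  with that have "\<forall>z\<in>ball c T. L ([:1, z:] ^ N) \<noteq> ?v" by metis
  then have "?M ([:1, z:] ^ N) \<noteq> 0" if "z \<in> ball c T" for z
    using that by (simp add: poly_power)
  moreover have "module_hom smult (*) ?M"
    by (rule linear_functional_polyI) (simp_all add: L.add L.scale algebra_simps)
  ultimately have "?M (\<Prod>j<N. [:1, u j:]) \<noteq> 0"
    using \<open>0 < T\<close> u by (intro grace_linear_functional[of ?M T c N u])
  then show False by (simp add: poly_prod)
qed

definition unit_integral :: "complex poly \<Rightarrow> complex" where
  "unit_integral p = integral {0..1} (\<lambda>s. poly p (of_real s))"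

lemma unit_integral_pderiv: "unit_integral (pderiv p) = poly p 1 - poly p 0"
proof -
  have "((\<lambda>s. poly (pderiv p) (of_real s))
      has_integral poly p (of_real 1) - poly p (of_real 0)) {0..1}"
  proof (rule fundamental_theorem_of_calculus)
    fix s :: real
    show "((\<lambda>s. poly p (of_real s)) has_vector_derivative poly (pderiv p) (of_real s))
        (at s within {0..1})"
      using has_vector_derivative_real_field[OF poly_DERIV[of p "of_real s"]]
      by (simp add: o_def has_vector_derivative_at_within)
  qed simp
  then show ?thesis by (simp add: unit_integral_def integral_unique)
qed

lemma linear_functional_unit_integral: "module_hom smult (*) unit_integral"
proof -
  have integrable: "(\<lambda>s. poly p (of_real s)) integrable_on {0..1}" for p :: "complex poly"
    by (intro integrable_continuous_interval continuous_intros)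
  show ?thesis
    by (rule linear_functional_polyI)
      (simp_all add: unit_integral_def integral_add[OF integrable integrable])
qed

lemma unit_integral_affine_power:
  "of_nat (Suc m) * unit_integral ([:1, v:] ^ m) = (\<Sum>k\<le>m. (1 + v) ^ k)"
proof (cases "v = 0")
  case True
  then show ?thesis by (simp add: unit_integral_def)
next
  case False
  interpret module_hom smult "(*)" unit_integral by (rule linear_functional_unit_integral)
  have "pderiv ([:1, v:] ^ Suc m) = smult (of_nat (Suc m) * v) ([:1, v:] ^ m)"
    by (simp only: pderiv_power_Suc) (simp add: pderiv_pCons mult.commute del: of_nat_Suc)
  then have "of_nat (Suc m) * v * unit_integral ([:1, v:] ^ m) = (1 + v) ^ Suc m - 1"
    using unit_integral_pderiv[of "[:1, v:] ^ Suc m"] by (simp add: scale del: of_nat_Suc power_Suc)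
  also have "\<dots> = v * (\<Sum>k\<le>m. (1 + v) ^ k)"
    by (simp add: power_diff_1_eq lessThan_Suc_atMost del: power_Suc)
  finally show ?thesis using False by (simp del: of_nat_Suc add: mult_ac)
qed

lemma pderiv_pcompose_affine:
  fixes p :: "'a :: field poly"
  assumes p': "pderiv p = smult k (poly_of_roots m w)" and far: "\<And>j. j < m \<Longrightarrow> a \<noteq> w j"
  shows "pderiv (p \<circ>\<^sub>p [:a, d:]) = smult (poly (pderiv p) a * d) (\<Prod>j<m. [:1, d / (a - w j):])"
proof -
  have factor: "[:- w j, 1:] \<circ>\<^sub>p [:a, d:] = smult (a - w j) [:1, d / (a - w j):]" if "j < m" for j
    using far[OF that] by (simp add: pcompose_pCons)
  have "poly_of_roots m w \<circ>\<^sub>p [:a, d:] = smult (\<Prod>j<m. a - w j) (\<Prod>j<m. [:1, d / (a - w j):])"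
    unfolding poly_of_roots_def pcompose_prod prod_smult[symmetric]
    by (intro prod.cong refl factor) simp
  then show ?thesis
    by (simp add: pderiv_pcompose p' pcompose_smult pderiv_pCons poly_poly_of_roots mult_ac)
qed

text \<open>If all critical points were equal to \<open>w\<close>, this would hold with \<open>y = (x - w) / (a - w)\<close>.\<close>

lemma poly_diff_eq_geometric_sum:
  fixes p :: "complex poly"
  assumes p': "pderiv p = smult k (poly_of_roots m w)" and "0 < T"
    and x: "\<And>j. j < m \<Longrightarrow> cmod (x - w j) < T * cmod (a - w j)"
  obtains y where "cmod y < T"
    "of_nat (Suc m) * (poly p x - poly p a) = poly (pderiv p) a * (x - a) * (\<Sum>k\<le>m. y ^ k)"
proof -
  interpret module_hom smult "(*)" unit_integral by (rule linear_functional_unit_integral)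
  define v where "v j = (x - a) / (a - w j)" for j
  have far: "a \<noteq> w j" if "j < m" for j
    using x[OF that] by auto
  have dist_minus_one: "dist (- 1) y = cmod (1 + y)" for y :: complex
    using norm_minus_cancel[of "1 + y"] by (simp add: dist_norm)
  have v_ball: "v j \<in> ball (- 1) T" if "j < m" for j
  proof -
    have "1 + v j = (x - w j) / (a - w j)" using far[OF that] by (simp add: v_def field_simps)
    then show ?thesis
      using x[OF that] far[OF that] by (simp add: dist_minus_one norm_divide divide_less_eq)
  qed
  obtain y where y: "y \<in> ball (- 1) T" "unit_integral (\<Prod>j<m. [:1, v j:]) = unit_integral ([:1, y:] ^ m)"
    by (rule walsh_coincidence[OF linear_functional_unit_integral \<open>0 < T\<close> v_ball])
  have "pderiv (p \<circ>\<^sub>p [:a, x - a:]) = smult (poly (pderiv p) a * (x - a)) (\<Prod>j<m. [:1, v j:])"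
    unfolding v_def by (rule pderiv_pcompose_affine[OF p' far])
  then have "poly p x - poly p a = poly (pderiv p) a * (x - a) * unit_integral ([:1, y:] ^ m)"
    using unit_integral_pderiv[of "p \<circ>\<^sub>p [:a, x - a:]"] y(2)
    by (simp add: scale poly_pcompose)
  then have "of_nat (Suc m) * (poly p x - poly p a)
      = poly (pderiv p) a * (x - a) * (of_nat (Suc m) * unit_integral ([:1, y:] ^ m))"
    by (simp only: mult.left_commute)
  also have "of_nat (Suc m) * unit_integral ([:1, y:] ^ m) = (\<Sum>k\<le>m. (1 + y) ^ k)"
    by (rule unit_integral_affine_power)
  finally show thesis
    using y(1) by (intro that[of "1 + y"]) (simp_all add: dist_minus_one)
qed

section \<open>Elementary inequalities\<close>

lemma ln_one_plus_ge_half: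
  fixes t :: real
  assumes "0 \<le> t" "t \<le> 1"
  shows "t / 2 \<le> ln (1 + t)"
proof -
  have "t / 2 \<le> t / (1 + t)" using assms by (intro divide_left_mono) auto
  also have "\<dots> \<le> ln (1 + t)" using ln_add1_ge[OF assms(1)] by (simp add: add.commute)
  finally show ?thesis .
qed

lemma affine_le_ln_affine:
  fixes x :: real
  assumes x: "u < v" "u \<le> x" "x \<le> v"
    and pos: "0 < p + q * u" "0 < p + q * v"
    and le: "\<alpha> + \<beta> * u \<le> ln (p + q * u)" "\<alpha> + \<beta> * v \<le> ln (p + q * v)"
  shows "0 < p + q * x" "\<alpha> + \<beta> * x \<le> ln (p + q * x)"
proof -
  define t where "t = (x - u) / (v - u)"
  have t: "0 \<le> t" "t \<le> 1" using x by (simp_all add: t_def)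
  have "t * (v - u) = x - u" using x by (simp add: t_def)
  then have x_eq: "x = (1 - t) * u + t * v" by (simp add: algebra_simps)
  have affine: "p + q * x = (1 - t) *\<^sub>R (p + q * u) + t *\<^sub>R (p + q * v)"
    unfolding x_eq by (simp add: algebra_simps)
  have "(1 - t) *\<^sub>R (p + q * u) + t *\<^sub>R (p + q * v) \<in> {0<..}"
    using pos t by (intro convexD_alt convex_real_interval) auto
  then show "0 < p + q * x" unfolding affine by simp
  have "\<alpha> + \<beta> * x = (1 - t) * (\<alpha> + \<beta> * u) + t * (\<alpha> + \<beta> * v)"
    unfolding x_eq by (simp add: algebra_simps)
  also have "\<dots> \<le> (1 - t) * ln (p + q * u) + t * ln (p + q * v)"
    using t le by (intro add_mono mult_left_mono) auto
  also have "\<dots> \<le> ln (p + q * x)"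
    unfolding affine using pos t by (intro concave_onD[OF ln_concave]) auto
  finally show "\<alpha> + \<beta> * x \<le> ln (p + q * x)" .
qed

lemma norm_geometric_sum_ge:
  fixes y :: "'a :: real_normed_field"
  assumes "norm y \<le> t" "t \<le> 1"
  shows "(1 - t ^ n) / 2 \<le> norm (\<Sum>k<n. y ^ k)"
proof -
  have "1 - t ^ n \<le> 1 - norm y ^ n" using assms by (simp add: power_mono)
  also have "\<dots> \<le> norm (1 - y ^ n)"
    using norm_triangle_ineq2[of 1 "y ^ n"] by (simp add: norm_power)
  also have "\<dots> = norm (1 - y) * norm (\<Sum>k<n. y ^ k)"
    by (simp add: one_diff_power_eq norm_mult)
  also have "norm (1 - y) \<le> 2"
    using norm_triangle_ineq4[of 1 y] assms by simp
  finally show ?thesis by (simp add: mult_right_mono)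
qed

lemma norm_geometric_sum_le:
  fixes y :: "'a :: real_normed_field"
  assumes "norm y \<le> t" "t < 1"
  shows "norm (\<Sum>k<n. y ^ k) \<le> 1 / (1 - t)"
proof -
  have "0 \<le> t" using assms(1) norm_ge_zero[of y] by linarith
  have "norm (\<Sum>k<n. y ^ k) \<le> (\<Sum>k<n. norm y ^ k)"
    by (rule order_trans[OF norm_sum]) (simp add: norm_power)
  also have "\<dots> \<le> (\<Sum>k<n. t ^ k)"
    using assms by (intro sum_mono power_mono) auto
  also have "(1 - t) * (\<Sum>k<n. t ^ k) \<le> 1"
    using \<open>0 \<le> t\<close> by (simp flip: one_diff_power_eq)
  then have "(\<Sum>k<n. t ^ k) \<le> 1 / (1 - t)"
    using assms(2) by (simp add: pos_le_divide_eq mult.commute)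
  finally show ?thesis .
qed

lemma cmod_of_real_diff_squared:
  "(cmod (of_real x - w))\<^sup>2 = x\<^sup>2 - 2 * x * Re w + (cmod w)\<^sup>2"
  unfolding cmod_power2 by (simp add: power2_eq_square algebra_simps)

lemma cmod_one_minus_of_real_mult_squared:
  "(cmod (1 - of_real c * w))\<^sup>2 = 1 - 2 * c * Re w + c\<^sup>2 * (cmod w)\<^sup>2"
  unfolding cmod_power2 by (simp add: power2_eq_square algebra_simps)

lemma one_minus_le_cmod_one_minus_mult:
  assumes "0 \<le> c"
  shows "1 - c * cmod z \<le> cmod (1 - of_real c * z)"
  using norm_triangle_ineq2[of 1 "of_real c * z"] assms by (simp add: norm_mult)

lemma cmod_one_minus_mult_ge:
  assumes "0 \<le> c" "cmod z \<le> 1"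
  shows "1 - c \<le> cmod (1 - of_real c * z)"
  using one_minus_le_cmod_one_minus_mult[OF assms(1), of z] mult_left_mono[OF assms(2,1)] by simp

lemma cmod_one_minus_mult_pos:
  assumes "0 \<le> c" "c < 1" "cmod z \<le> 1"
  shows "0 < cmod (1 - of_real c * z)"
  using cmod_one_minus_mult_ge[of c z] assms by linarith

lemma sum_Re_le_of_prod_dist_ge:
  fixes x L :: real
  assumes "finite A" and disc: "\<And>k. k \<in> A \<Longrightarrow> cmod (z k) \<le> 1"
    and prod_ge: "exp (- L) \<le> (\<Prod>k\<in>A. cmod (of_real x - z k))"
  shows "2 * x * (\<Sum>k\<in>A. Re (z k)) \<le> real (card A) * x\<^sup>2 + 2 * L"
proof -
  have "cmod (of_real x - z k) \<le> exp (x\<^sup>2 / 2 - x * Re (z k))" if "k \<in> A" for k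
  proof (rule power2_le_imp_le)
    have "(cmod (of_real x - z k))\<^sup>2 \<le> 1 + (x\<^sup>2 - 2 * x * Re (z k))"
      using disc[OF that] by (simp add: cmod_of_real_diff_squared power_le_one)
    also have "\<dots> \<le> exp (x\<^sup>2 - 2 * x * Re (z k))" by (rule exp_ge_add_one_self)
    also have "\<dots> = (exp (x\<^sup>2 / 2 - x * Re (z k)))\<^sup>2" by (simp add: algebra_simps flip: exp_double)
    finally show "(cmod (of_real x - z k))\<^sup>2 \<le> (exp (x\<^sup>2 / 2 - x * Re (z k)))\<^sup>2" .
  qed simp
  then have "exp (- L) \<le> (\<Prod>k\<in>A. exp (x\<^sup>2 / 2 - x * Re (z k)))"
    by (intro order_trans[OF prod_ge] prod_mono) auto
  also have "\<dots> = exp (real (card A) * (x\<^sup>2 / 2) - x * (\<Sum>k\<in>A. Re (z k)))"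
    using \<open>finite A\<close> by (simp add: sum_subtractf sum_distrib_left flip: exp_sum)
  finally show ?thesis by simp
qed

lemma cmod_of_real_diff_le_mult_exp:
  fixes a t :: real and w :: complex
  assumes "t \<le> a" "2 * Re w \<le> a + t" and R: "0 < R" "cmod (of_real a - w) \<le> R"
  shows "cmod (of_real t - w)
    \<le> cmod (of_real a - w) * exp (- ((a - t) * (a + t - 2 * Re w)) / (2 * R\<^sup>2))"
proof (rule power2_le_imp_le)
  define d where "d = (cmod (of_real a - w))\<^sup>2"
  define e where "e = (a - t) * (a + t - 2 * Re w)"
  have "0 \<le> e" unfolding e_def using assms(1,2) by (intro mult_nonneg_nonneg) auto
  moreover have "d \<le> R\<^sup>2" unfolding d_def using R by (intro power_mono) auto
  ultimately have "d * (e / R\<^sup>2) \<le> R\<^sup>2 * (e / R\<^sup>2)" by (intro mult_right_mono) auto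
  moreover have "(cmod (of_real t - w))\<^sup>2 = d - e"
    unfolding d_def e_def cmod_of_real_diff_squared by (simp add: power2_eq_square algebra_simps)
  ultimately have "(cmod (of_real t - w))\<^sup>2 \<le> d * (1 + - e / R\<^sup>2)"
    using R by (simp add: algebra_simps)
  also have "\<dots> \<le> d * exp (- e / R\<^sup>2)"
    by (intro mult_left_mono exp_ge_add_one_self) (simp add: d_def)
  also have "\<dots> = (cmod (of_real a - w) * exp (- e / (2 * R\<^sup>2)))\<^sup>2"
    by (simp add: d_def power_mult_distrib flip: exp_double)
  finally show "(cmod (of_real t - w))\<^sup>2 \<le> (cmod (of_real a - w)
      * exp (- ((a - t) * (a + t - 2 * Re w)) / (2 * R\<^sup>2)))\<^sup>2"
    unfolding e_def .
qed simp

section \<open>The lune\<close>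

definition lune :: "real \<Rightarrow> complex set" where
  "lune a = {w. cmod w \<le> 1 \<and> 1 < cmod (of_real a - w)}"

lemma lune_cmod_squared_gt:
  assumes "w \<in> lune a"
  shows "1 - a\<^sup>2 + 2 * a * Re w < (cmod w)\<^sup>2"
proof -
  have "1 < (cmod (of_real a - w))\<^sup>2" using assms by (simp add: lune_def one_less_power)
  then show ?thesis by (simp add: cmod_of_real_diff_squared)
qed

lemma lune_Re_less:
  assumes "0 < a" "w \<in> lune a"
  shows "Re w < a / 2"
proof -
  have "(cmod w)\<^sup>2 \<le> 1" using assms(2) by (simp add: lune_def power_le_one)
  then have "a * (2 * Re w) < a * a"
    using lune_cmod_squared_gt[OF assms(2)] by (simp add: power2_eq_square)
  then show ?thesis using assms(1) by simp
qed

lemma lune_dist_less: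
  fixes a x :: real
  assumes a: "0 < a" "a < 1" and x: "0 \<le> x" "x < a" and w: "w \<in> lune a"
  shows "cmod (of_real x - w) < (1 - x * (a - x) / 2) * cmod (of_real a - w)"
proof (rule power2_less_imp_less)
  define d where "d = (cmod (of_real a - w))\<^sup>2"
  define q where "q = x * (a - x)"
  have d: "1 < d" using w by (simp add: d_def lune_def one_less_power)
  have "(cmod w)\<^sup>2 \<le> 1" using w by (simp add: lune_def power_le_one)
  have "a * x < 1 * 1" using a x by (intro mult_strict_mono) auto
  then have "0 < (d - 1) * (1 - a * x) + (1 - (cmod w)\<^sup>2)"
    using d \<open>(cmod w)\<^sup>2 \<le> 1\<close> by (intro add_pos_nonneg mult_pos_pos) auto
  also have "\<dots> = a * (a + x - 2 * Re w - x * d)"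
    unfolding d_def cmod_of_real_diff_squared by (simp add: power2_eq_square algebra_simps)
  finally have "0 < (a - x) * (a + x - 2 * Re w - x * d)"
    using a x by (simp add: zero_less_mult_iff)
  also have "\<dots> = (1 - q) * d - (cmod (of_real x - w))\<^sup>2"
    unfolding d_def q_def cmod_of_real_diff_squared by (simp add: power2_eq_square algebra_simps)
  finally have "(cmod (of_real x - w))\<^sup>2 < (1 - q) * d" by simp
  also have "\<dots> \<le> (1 - q / 2)\<^sup>2 * d"
    using d by (intro mult_right_mono) (simp_all add: power2_eq_square algebra_simps)
  finally show "(cmod (of_real x - w))\<^sup>2 < ((1 - x * (a - x) / 2) * cmod (of_real a - w))\<^sup>2"
    by (simp only: power_mult_distrib d_def q_def)
  have "q \<le> 1 * 1" unfolding q_def using a x by (intro mult_mono) auto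
  then show "0 \<le> (1 - x * (a - x) / 2) * cmod (of_real a - w)" by (simp add: q_def)
qed

text \<open>\<open>\<bar>1 - c w\<bar>\<close> equals \<open>lune_corner a c\<close> at the two corners of the lune, where \<open>Re w = a / 2\<close>; on
  the arc \<open>\<bar>a - w\<bar> = 1\<close> it is \<open>1 + c - a c\<close> at \<open>Re w = a - 1\<close>, and it is \<open>1 + c\<close> at \<open>w = - 1\<close>.
  The slope is that of the flatter of the two chords of the logarithm from the corners.\<close>

definition lune_corner :: "real \<Rightarrow> real \<Rightarrow> real" where
  "lune_corner a c = sqrt (1 + c\<^sup>2 - a * c)"

definition lune_slope :: "real \<Rightarrow> real \<Rightarrow> real" where
  "lune_slope a c = min ((ln (1 + c - a * c) - ln (lune_corner a c)) / (1 - a / 2))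
    ((ln (1 + c) - ln (lune_corner a c)) / (1 + a / 2))"

lemma lune_corner_radicand_pos:
  fixes a c :: real
  assumes "a * c < 1"
  shows "0 < 1 + c\<^sup>2 - a * c"
  using assms zero_le_power2[of c] by linarith

lemma lune_corner_pos: "a * c < 1 \<Longrightarrow> 0 < lune_corner a c"
  using lune_corner_radicand_pos[of a c] by (simp add: lune_corner_def)

lemma lune_corner_squared: "a * c < 1 \<Longrightarrow> (lune_corner a c)\<^sup>2 = 1 + c\<^sup>2 - a * c"
  using lune_corner_radicand_pos[of a c] by (simp add: lune_corner_def)

lemma ln_lune_corner_bounds:
  assumes "0 \<le> c" "c \<le> a" "a \<le> 1"
  shows "- (c * (a - c)) \<le> ln (lune_corner a c)" "ln (lune_corner a c) \<le> 0"
proof -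
  define x where "x = c * (a - c)"
  have "c * (a - c) \<le> c * (1 - c)" using assms by (intro mult_left_mono) auto
  also have "\<dots> \<le> 1 / 4"
    using zero_le_power2[of "c - 1 / 2"] by (simp add: power2_eq_square algebra_simps)
  finally have x: "0 \<le> x" "x \<le> 1 / 4" using assms by (simp_all add: x_def)
  have "lune_corner a c = sqrt (1 - x)"
    by (simp add: lune_corner_def x_def power2_eq_square algebra_simps)
  then have ln_corner: "ln (lune_corner a c) = ln (1 - x) / 2" using x by (simp add: ln_sqrt)
  have "- x - 2 * x\<^sup>2 \<le> ln (1 - x)" using x by (intro ln_one_minus_pos_lower_bound) auto
  moreover have "x * x \<le> x * (1 / 4)" using x by (intro mult_left_mono)
  ultimately show "- (c * (a - c)) \<le> ln (lune_corner a c)"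
    unfolding ln_corner x_def[symmetric] power2_eq_square using x by simp
  show "ln (lune_corner a c) \<le> 0" unfolding ln_corner using x by simp
qed

lemma lune_slope_nonneg:
  assumes "0 < a" "a < 1" "0 \<le> c" "c \<le> a"
  shows "0 \<le> lune_slope a c"
proof -
  have "ln (lune_corner a c) \<le> 0" using assms by (intro ln_lune_corner_bounds(2)) auto
  moreover have "a * c \<le> c" using assms by (simp add: mult_left_le_one_le)
  then have "0 \<le> ln (1 + c - a * c)" "0 \<le> ln (1 + c)"
    using assms(3) by (intro ln_ge_zero, simp)+
  ultimately show ?thesis
    using assms(1,2) unfolding lune_slope_def by (intro min.boundedI divide_nonneg_nonneg) auto
qed

lemma lune_slope_chords:
  assumes "0 < a" "a < 1"
  shows "ln (lune_corner a c) + lune_slope a c * (1 - a / 2) \<le> ln (1 + c - a * c)"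
    and "ln (lune_corner a c) + lune_slope a c * (1 + a / 2) \<le> ln (1 + c)"
proof -
  have "lune_slope a c * (1 - a / 2) \<le> ln (1 + c - a * c) - ln (lune_corner a c)"
    "lune_slope a c * (1 + a / 2) \<le> ln (1 + c) - ln (lune_corner a c)"
    using assms by (simp_all add: lune_slope_def flip: pos_le_divide_eq)
  then show "ln (lune_corner a c) + lune_slope a c * (1 - a / 2) \<le> ln (1 + c - a * c)"
    "ln (lune_corner a c) + lune_slope a c * (1 + a / 2) \<le> ln (1 + c)" by simp_all
qed

lemma lune_ln_cmod_ge_near_corner:
  assumes a: "0 < a" "a < 1" and c: "0 \<le> c" "c \<le> 1" and w: "w \<in> lune a" "a - 1 \<le> Re w"
  shows "ln (lune_corner a c) + lune_slope a c * (a / 2 - Re w) \<le> ln (cmod (1 - of_real c * w))"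
proof -
  let ?s = "lune_corner a c" and ?A = "lune_slope a c"
  let ?p = "1 + c\<^sup>2 * (1 - a\<^sup>2)" and ?q = "2 * a * c\<^sup>2 - 2 * c"
  have "a * c \<le> a" using a c by (simp add: mult_left_le)
  then have ac: "a * c < 1" using a by linarith
  have s_pos: "0 < ?s" using ac by (rule lune_corner_pos)
  have far_end: "0 < 1 + c - a * c" using ac c by linarith
  have ends: "?p + ?q * (a / 2) = ?s\<^sup>2" "?p + ?q * (a - 1) = (1 + c - a * c)\<^sup>2"
    unfolding lune_corner_squared[OF ac] by (simp_all add: power2_eq_square algebra_simps)
  have pos: "0 < ?p + ?q * (a - 1)" "0 < ?p + ?q * (a / 2)"
    using s_pos far_end by (simp_all only: ends zero_less_power)
  have "2 * (ln ?s + ?A * (a / 2)) + (- 2 * ?A) * (a - 1) \<le> ln (?p + ?q * (a - 1))"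
    "2 * (ln ?s + ?A * (a / 2)) + (- 2 * ?A) * (a / 2) \<le> ln (?p + ?q * (a / 2))"
    using lune_slope_chords(1)[OF a, of c] s_pos far_end unfolding ends
    by (simp_all add: ln_realpow) (simp add: algebra_simps)
  moreover have "a - 1 < a / 2" "Re w \<le> a / 2" using a lune_Re_less[OF a(1) w(1)] by simp_all
  ultimately have affine: "0 < ?p + ?q * Re w"
    "2 * (ln ?s + ?A * (a / 2)) + (- 2 * ?A) * Re w \<le> ln (?p + ?q * Re w)"
    using affine_le_ln_affine[OF _ w(2) _ pos] by blast+
  have "?p + ?q * Re w = 1 - 2 * c * Re w + c\<^sup>2 * (1 - a\<^sup>2 + 2 * a * Re w)"
    by (simp add: algebra_simps)
  also have "\<dots> \<le> (cmod (1 - of_real c * w))\<^sup>2"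
    unfolding cmod_one_minus_of_real_mult_squared
    using lune_cmod_squared_gt[OF w(1)] by (intro add_left_mono mult_left_mono) auto
  finally have "ln (?p + ?q * Re w) \<le> ln ((cmod (1 - of_real c * w))\<^sup>2)"
    using affine(1) by (intro ln_mono)
  also have "\<dots> = 2 * ln (cmod (1 - of_real c * w))"
    by (simp add: ln_realpow)
  finally show ?thesis using affine(2) by (simp add: right_diff_distrib)
qed

lemma ln_cmod_ge_far_from_corner:
  assumes a: "0 < a" "a < 1" and c: "0 \<le> c" "c \<le> 1" and w: "- 1 \<le> Re w" "Re w \<le> a - 1"
  shows "ln (lune_corner a c) + lune_slope a c * (a / 2 - Re w) \<le> ln (cmod (1 - of_real c * w))"
proof -
  let ?s = "lune_corner a c" and ?A = "lune_slope a c"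
  have "a * c \<le> a" using a c by (simp add: mult_left_le)
  then have "a * c < 1" using a by linarith
  then have pos: "0 < 1 + (- c) * (- 1)" "0 < 1 + (- c) * (a - 1)"
    using c by (simp_all add: algebra_simps)
  have "(ln ?s + ?A * (a / 2)) + (- ?A) * (- 1) \<le> ln (1 + (- c) * (- 1))"
    "(ln ?s + ?A * (a / 2)) + (- ?A) * (a - 1) \<le> ln (1 + (- c) * (a - 1))"
    using lune_slope_chords[OF a, of c] by (simp_all add: algebra_simps)
  moreover have "- 1 < a - 1" using a by simp
  ultimately have affine: "0 < 1 + (- c) * Re w"
    "(ln ?s + ?A * (a / 2)) + (- ?A) * Re w \<le> ln (1 + (- c) * Re w)"
    using affine_le_ln_affine[OF _ w pos] by blast+
  have "1 + (- c) * Re w \<le> cmod (1 - of_real c * w)"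
    using complex_Re_le_cmod[of "1 - of_real c * w"] by simp
  then have "ln (1 + (- c) * Re w) \<le> ln (cmod (1 - of_real c * w))"
    using affine(1) by (intro ln_mono)
  then show ?thesis using affine(2) by (simp add: right_diff_distrib)
qed

lemma lune_ln_cmod_ge:
  assumes a: "0 < a" "a < 1" and c: "0 \<le> c" "c \<le> 1" and w: "w \<in> lune a"
  shows "ln (lune_corner a c) + lune_slope a c * (a / 2 - Re w) \<le> ln (cmod (1 - of_real c * w))"
proof (cases "a - 1 \<le> Re w")
  case True
  then show ?thesis by (rule lune_ln_cmod_ge_near_corner[OF a c w])
next
  case False
  have "cmod w \<le> 1" using w by (simp add: lune_def)
  then have "- 1 \<le> Re w" using abs_Re_le_cmod[of w] by linarith
  with False show ?thesis by (intro ln_cmod_ge_far_from_corner a c) auto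
qed

section \<open>Blaschke factors\<close>

lemma cmod_blaschke_identity:
  "(cmod (1 - of_real c * z))\<^sup>2 - (cmod (z - of_real c))\<^sup>2 = (1 - c\<^sup>2) * (1 - (cmod z)\<^sup>2)"
  unfolding cmod_power2 by (simp add: power2_eq_square algebra_simps)

lemma cmod_blaschke_ge_radial:
  assumes c: "0 \<le> c" "c < 1" and z: "cmod z \<le> 1"
  shows "(cmod z - c) / (1 - c * cmod z) \<le> cmod (z - of_real c) / cmod (1 - of_real c * z)"
    (is "?P / ?Q \<le> ?p / ?q")
proof (rule power2_le_imp_le)
  define k where "k = (1 - c\<^sup>2) * (1 - (cmod z)\<^sup>2)"
  have "0 \<le> k" using c z by (simp add: k_def power_le_one)
  have "c * cmod z \<le> c" using c z by (intro mult_left_le)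
  then have "0 < ?Q" using c by linarith
  have "0 < ?q" using c z by (rule cmod_one_minus_mult_pos)
  have "?P\<^sup>2 = ?Q\<^sup>2 - k" by (simp add: k_def power2_eq_square algebra_simps)
  then have "(?P / ?Q)\<^sup>2 = (?Q\<^sup>2 - k) / ?Q\<^sup>2" by (simp only: power_divide)
  also have "\<dots> = 1 - k / ?Q\<^sup>2" using \<open>0 < ?Q\<close> by (simp add: diff_divide_distrib)
  also have "\<dots> \<le> 1 - k / ?q\<^sup>2"
    using \<open>0 \<le> k\<close> \<open>0 < ?Q\<close> \<open>0 < ?q\<close> one_minus_le_cmod_one_minus_mult[OF c(1), of z]
    by (intro diff_left_mono divide_left_mono power_mono mult_pos_pos zero_less_power) auto
  also have "?p\<^sup>2 = ?q\<^sup>2 - k" using cmod_blaschke_identity[of c z] by (simp add: k_def)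
  then have "1 - k / ?q\<^sup>2 = (?p / ?q)\<^sup>2"
    using \<open>0 < ?q\<close> by (simp add: power_divide diff_divide_distrib)
  finally show "(?P / ?Q)\<^sup>2 \<le> (?p / ?q)\<^sup>2" .
qed simp

lemma cmod_blaschke_ge_of_dist_ge:
  assumes c: "0 \<le> c" "c < 1" and z: "cmod z \<le> 1"
    and r: "0 \<le> r" "r * (1 - c\<^sup>2) \<le> cmod (z - of_real c)"
  shows "r / (1 + c * r) \<le> cmod (z - of_real c) / cmod (1 - of_real c * z)"
proof -
  have "0 < cmod (1 - of_real c * z)" using c z by (rule cmod_one_minus_mult_pos)
  have "1 - of_real c * z = of_real (1 - c\<^sup>2) - of_real c * (z - of_real c)"
    by (simp add: power2_eq_square algebra_simps)
  then have "cmod (1 - of_real c * z) \<le> \<bar>1 - c\<^sup>2\<bar> + c * cmod (z - of_real c)"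
    using norm_triangle_ineq4[of "of_real (1 - c\<^sup>2)" "of_real c * (z - of_real c)"] c
    by (simp add: norm_mult del: of_real_diff of_real_power)
  also have "\<bar>1 - c\<^sup>2\<bar> = 1 - c\<^sup>2" using c by (simp add: power_le_one)
  finally have "r * cmod (1 - of_real c * z) \<le> r * (1 - c\<^sup>2 + c * cmod (z - of_real c))"
    using r(1) by (rule mult_left_mono)
  also have "\<dots> \<le> cmod (z - of_real c) * (1 + c * r)"
    using r(2) by (simp add: algebra_simps)
  finally show ?thesis
    using \<open>0 < cmod (1 - of_real c * z)\<close> c r(1) by (simp add: field_simps add_pos_nonneg)
qed

lemma blaschke_cosh_eq:
  fixes c t :: real
  shows "(exp t - c) * (1 - c * exp t) = exp t * (1 + c\<^sup>2 - 2 * c * cosh t)"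
  by (simp add: cosh_field_def exp_minus field_simps power2_eq_square)

lemma concave_on_ln_blaschke:
  fixes c :: real
  assumes c: "0 < c" "c < 1"
  shows "concave_on {ln c<..0} (\<lambda>t. ln (exp t - c) - ln (1 - c * exp t))"
  unfolding concave_on_def
proof (rule convex_on_realI)
  let ?g = "\<lambda>t. 1 + c\<^sup>2 - 2 * c * cosh t"
  have dom: "0 < exp t - c" "0 < 1 - c * exp t" "0 < ?g t" if "t \<in> {ln c<..0}" for t
  proof -
    show "0 < exp t - c" using that c exp_less_cancel_iff[of "ln c" t] by simp
    have "c * exp t \<le> c" using that c by (intro mult_left_le) auto
    then show "0 < 1 - c * exp t" using c by linarith
    with \<open>0 < exp t - c\<close> have "0 < exp t * ?g t"
      by (simp only: blaschke_cosh_eq[symmetric] mult_pos_pos)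
    then show "0 < ?g t" by (simp add: zero_less_mult_iff)
  qed
  show "((\<lambda>t. - (ln (exp t - c) - ln (1 - c * exp t))) has_real_derivative
      - ((1 - c\<^sup>2) / ?g t)) (at t)"
    if "t \<in> {ln c<..0}" for t
  proof -
    have "exp t / (exp t - c) + c * exp t / (1 - c * exp t)
        = exp t * (1 - c\<^sup>2) / ((exp t - c) * (1 - c * exp t))"
      using dom[OF that] by (simp add: field_simps power2_eq_square)
    also have "\<dots> = (1 - c\<^sup>2) / ?g t" unfolding blaschke_cosh_eq by simp
    finally have deriv_eq: "exp t / (exp t - c) + c * exp t / (1 - c * exp t) = (1 - c\<^sup>2) / ?g t" .
    have "((\<lambda>t. - (ln (exp t - c) - ln (1 - c * exp t))) has_real_derivative
        - (exp t / (exp t - c) + c * exp t / (1 - c * exp t))) (at t)"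
      using dom[OF that] by (auto intro!: derivative_eq_intros)
    then show ?thesis unfolding deriv_eq .
  qed
  show "- ((1 - c\<^sup>2) / ?g s) \<le> - ((1 - c\<^sup>2) / ?g t)"
    if st: "s \<in> {ln c<..0}" "t \<in> {ln c<..0}" "s \<le> t" for s t
  proof -
    have "cosh t \<le> cosh s" using st by (simp add: cosh_real_nonpos_le_iff)
    then have "?g s \<le> ?g t" using c by simp
    then have "(1 - c\<^sup>2) / ?g t \<le> (1 - c\<^sup>2) / ?g s"
      using dom(3)[OF st(1)] dom(3)[OF st(2)] c
      by (intro divide_left_mono mult_pos_pos) (auto simp: power_le_one)
    then show ?thesis by simp
  qed
qed (simp add: is_interval_connected is_interval_oc)

lemma powr_le_blaschke_radial:
  fixes c \<rho> \<kappa> x :: real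
  assumes c: "0 < c" "c < 1" and \<rho>: "c < \<rho>" "\<rho> < 1"
    and \<kappa>: "\<rho> powr \<kappa> \<le> (\<rho> - c) / (1 - c * \<rho>)" and x: "\<rho> \<le> x" "x \<le> 1"
  shows "x powr \<kappa> \<le> (x - c) / (1 - c * x)"
proof -
  let ?f = "\<lambda>t. ln (exp t - c) - ln (1 - c * exp t)"
  have f_ln: "?f (ln y) = ln ((y - c) / (1 - c * y))" "0 < (y - c) / (1 - c * y)"
    if "c < y" "y \<le> 1" for y
  proof -
    have "c * y \<le> c" using that c by (intro mult_left_le) auto
    then have "0 < 1 - c * y" using c by linarith
    then show "?f (ln y) = ln ((y - c) / (1 - c * y))" "0 < (y - c) / (1 - c * y)"
      using that c by (simp_all add: ln_div)
  qed
  define s where "s = ln x / ln \<rho>"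
  have "ln \<rho> < 0" "0 < \<rho>" "0 < x" using \<rho> c x by simp_all
  then have "ln \<rho> \<le> ln x" "ln x \<le> 0" using x by simp_all
  then have s: "0 \<le> s" "s \<le> 1" and ln_x: "ln x = s * ln \<rho>"
    using \<open>ln \<rho> < 0\<close> by (auto simp: s_def divide_nonpos_neg divide_le_eq)
  have "\<kappa> * ln \<rho> \<le> ?f (ln \<rho>)"
    using ln_mono[OF \<kappa>] f_ln[of \<rho>] \<rho> \<open>0 < \<rho>\<close> by (simp add: ln_powr)
  then have "s * (\<kappa> * ln \<rho>) \<le> s * ?f (ln \<rho>)" using s(1) by (rule mult_left_mono)
  then have "\<kappa> * ln x \<le> (1 - s) * ?f 0 + s * ?f (ln \<rho>)"
    by (simp add: ln_x mult.left_commute)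
  also have "\<dots> \<le> ?f ((1 - s) *\<^sub>R 0 + s *\<^sub>R ln \<rho>)"
    using s c \<rho> by (intro concave_onD[OF concave_on_ln_blaschke]) auto
  also have "\<dots> = ln ((x - c) / (1 - c * x))"
    using f_ln(1)[of x] \<rho> x by (simp add: ln_x)
  finally have "ln (x powr \<kappa>) \<le> ln ((x - c) / (1 - c * x))"
    using \<open>0 < x\<close> by (simp add: ln_powr)
  then show ?thesis
    using f_ln(2)[of x] \<rho> x \<open>0 < x\<close> by (subst (asm) ln_le_cancel_iff) auto
qed

text \<open>\<open>(c + r) / (1 + c r)\<close> is the farther from \<open>0\<close> of the two real points at pseudohyperbolic
  distance \<open>r\<close> from \<open>c\<close>.\<close>

lemma hyperbolic_shift:
  fixes c r :: real
  assumes c: "0 < c" "c < 1" and r: "0 < r" "r < 1"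
  defines "\<rho> \<equiv> (c + r) / (1 + c * r)"
  shows "c < \<rho>" "\<rho> < 1" "(\<rho> - c) / (1 - c * \<rho>) = r"
proof -
  have "0 < 1 - c\<^sup>2" using c by (simp add: power_less_one_iff)
  have "0 < 1 + c * r" using c r by (simp add: add_pos_pos)
  then have diff: "\<rho> - c = r * ((1 - c\<^sup>2) / (1 + c * r))" "1 - c * \<rho> = (1 - c\<^sup>2) / (1 + c * r)"
    "1 - \<rho> = (1 - c) * (1 - r) / (1 + c * r)"
    by (simp_all add: \<rho>_def field_simps power2_eq_square)
  have "0 < \<rho> - c" "0 < 1 - \<rho>"
    unfolding diff using \<open>0 < 1 - c\<^sup>2\<close> \<open>0 < 1 + c * r\<close> c r by simp_all
  then show "c < \<rho>" "\<rho> < 1" by simp_all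
  show "(\<rho> - c) / (1 - c * \<rho>) = r"
    unfolding diff using \<open>0 < 1 - c\<^sup>2\<close> \<open>0 < 1 + c * r\<close> by simp
qed

lemma powr_le_cmod_blaschke:
  fixes c r \<kappa> :: real
  defines "\<rho> \<equiv> (c + r) / (1 + c * r)"
  assumes c: "0 < c" "c < 1" and r: "0 < r" "r < 1"
    and \<kappa>: "0 \<le> \<kappa>" "\<rho> powr \<kappa> \<le> r / (1 + c * r)"
    and z: "cmod z \<le> 1" "r * (1 - c\<^sup>2) \<le> cmod (z - of_real c)"
  shows "cmod z powr \<kappa> \<le> cmod (z - of_real c) / cmod (1 - of_real c * z)"
proof (cases "\<rho> \<le> cmod z")
  case True
  note \<rho> = hyperbolic_shift[OF c r, folded \<rho>_def]
  have "r / (1 + c * r) \<le> r" using c r by (simp add: divide_le_eq add_pos_pos)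
  then have "cmod z powr \<kappa> \<le> (cmod z - c) / (1 - c * cmod z)"
    using \<rho>(3) \<kappa>(2) by (intro powr_le_blaschke_radial[OF c \<rho>(1,2) _ True z(1)]) simp
  also have "\<dots> \<le> cmod (z - of_real c) / cmod (1 - of_real c * z)"
    using c z(1) by (intro cmod_blaschke_ge_radial) auto
  finally show ?thesis .
next
  case False
  then have "cmod z powr \<kappa> \<le> \<rho> powr \<kappa>" using \<kappa>(1) by (intro powr_mono2) auto
  also have "\<dots> \<le> r / (1 + c * r)" by (rule \<kappa>(2))
  also have "r / (1 + c * r) \<le> cmod (z - of_real c) / cmod (1 - of_real c * z)"
    using c r z by (intro cmod_blaschke_ge_of_dist_ge) auto
  finally show ?thesis .
qed

section \<open>The size of a counterexample on the real axis\<close>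

locale sendov_counterexample =
  fixes a :: real and n m :: nat and Z w :: "nat \<Rightarrow> complex"
  assumes a: "0 < a" "a < 1" and n: "n = Suc m"
    and Z_0: "Z 0 = of_real a" and Z_disc: "\<And>k. k < n \<Longrightarrow> cmod (Z k) \<le> 1"
    and pderiv: "pderiv (poly_of_roots n Z) = smult (of_nat n) (poly_of_roots m w)"
    and far: "\<And>j. j < m \<Longrightarrow> 1 < cmod (of_real a - w j)"
begin

abbreviation P :: "complex poly" where "P \<equiv> poly_of_roots n Z"

definition D :: real where "D = (\<Prod>j<m. cmod (of_real a - w j))"

lemma n_pos: "0 < n" by (simp add: n)

lemma poly_P_a: "poly P (of_real a) = 0"
  using Z_0 n_pos by (auto simp: poly_poly_of_roots_eq_0_iff intro!: exI[of _ 0])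

lemma cmod_poly_pderiv: "cmod (poly (pderiv P) x) = real n * (\<Prod>j<m. cmod (x - w j))"
  by (simp add: pderiv norm_mult cmod_poly_of_roots)

lemma cmod_poly_pderiv_a: "cmod (poly (pderiv P) (of_real a)) = real n * D"
  by (simp add: cmod_poly_pderiv D_def)

lemma D_ge_1: "1 \<le> D"
  unfolding D_def using far by (intro prod_ge_1) (simp add: less_imp_le)

lemma critical_in_lune:
  assumes "j < m"
  shows "w j \<in> lune a"
proof -
  have "pderiv P \<noteq> 0" using degree_poly_of_roots[of n Z] n by (simp add: pderiv_eq_0_iff)
  moreover have "poly (pderiv P) (w j) = 0"
    using assms by (auto simp: pderiv poly_poly_of_roots_eq_0_iff)
  ultimately have "w j \<in> convex hull {z. poly P z = 0}" by (rule gauss_lucas)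
  also have "\<dots> \<subseteq> cball 0 1"
    by (rule hull_minimal) (auto simp: poly_poly_of_roots_eq_0_iff Z_disc)
  finally show ?thesis using far[OF assms] by (simp add: lune_def)
qed

lemma poly_P_eq_geometric_sum:
  assumes "0 < T" "\<And>j. j < m \<Longrightarrow> cmod (x - w j) < T * cmod (of_real a - w j)"
  obtains y where "cmod y < T"
    "of_nat n * poly P x = poly (pderiv P) (of_real a) * (x - of_real a) * (\<Sum>k<n. y ^ k)"
  using poly_diff_eq_geometric_sum[OF pderiv assms]
  by (metis n poly_P_a diff_zero lessThan_Suc_atMost)

lemma cmod_poly_P_eq_geometric_sum:
  assumes x: "0 \<le> x" "x < a"
  obtains y where "cmod y < 1 - x * (a - x) / 2"
    "cmod (poly P (of_real x)) = D * (a - x) * cmod (\<Sum>k<n. y ^ k)"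
proof -
  have "x * (a - x) \<le> 1 * 1" using x a by (intro mult_mono) auto
  then have "0 < 1 - x * (a - x) / 2" by simp
  then obtain y where y: "cmod y < 1 - x * (a - x) / 2"
    "of_nat n * poly P (of_real x)
      = poly (pderiv P) (of_real a) * (of_real x - of_real a) * (\<Sum>k<n. y ^ k)"
    by (rule poly_P_eq_geometric_sum)
      (use lune_dist_less[OF a x] critical_in_lune in auto)
  have "cmod (of_real x - of_real a) = a - x" using x by (simp flip: of_real_diff)
  then have "real n * cmod (poly P (of_real x)) = real n * (D * (a - x) * cmod (\<Sum>k<n. y ^ k))"
    using arg_cong[OF y(2), of cmod]
    by (simp add: norm_mult cmod_poly_pderiv_a mult.assoc)
  then show thesis using y(1) n_pos by (intro that[of y]) simp_all
qed

lemma cmod_poly_P_ge: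
  assumes x: "0 \<le> x" "x < a"
  shows "D * (a - x) * ((1 - (1 - x * (a - x) / 2) ^ n) / 2) \<le> cmod (poly P (of_real x))"
proof -
  obtain y where y: "cmod y < 1 - x * (a - x) / 2"
    "cmod (poly P (of_real x)) = D * (a - x) * cmod (\<Sum>k<n. y ^ k)"
    by (rule cmod_poly_P_eq_geometric_sum[OF x])
  have "0 \<le> x * (a - x)" using x by simp
  then show ?thesis
    unfolding y(2) using x y(1) D_ge_1 by (intro mult_left_mono norm_geometric_sum_ge) auto
qed

lemma cmod_poly_P_le:
  assumes x: "0 < x" "x < a"
  shows "cmod (poly P (of_real x)) \<le> 2 * D / x"
proof -
  obtain y where y: "cmod y < 1 - x * (a - x) / 2"
    "cmod (poly P (of_real x)) = D * (a - x) * cmod (\<Sum>k<n. y ^ k)"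
    using x by (auto intro: cmod_poly_P_eq_geometric_sum[of x])
  have "0 < x * (a - x)" using x by simp
  then have "cmod (\<Sum>k<n. y ^ k) \<le> 1 / (1 - (1 - x * (a - x) / 2))"
    using y(1) by (intro norm_geometric_sum_le) auto
  then have "cmod (poly P (of_real x)) \<le> D * (a - x) * (1 / (1 - (1 - x * (a - x) / 2)))"
    unfolding y(2) using x D_ge_1 by (intro mult_left_mono) auto
  also have "\<dots> = 2 * D / x" using x by (simp add: field_simps)
  finally show ?thesis .
qed

lemma poly_P_neq_0_near:
  assumes c: "0 < c" "c < a" and z: "cmod (z - of_real c) < c * (a - c) / 2"
  shows "poly P z \<noteq> 0"
proof -
  define q where "q = c * (a - c)"
  have "q < 1 * (a - c)" unfolding q_def using c a by (intro mult_strict_right_mono) auto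
  have "0 < q" using c by (simp add: q_def)
  have "cmod (z - w j) < 1 * cmod (of_real a - w j)" if "j < m" for j
  proof -
    have "cmod (z - w j) \<le> cmod (z - of_real c) + cmod (of_real c - w j)"
      using norm_triangle_ineq[of "z - of_real c" "of_real c - w j"] by simp
    moreover have "q / 2 * 1 \<le> q / 2 * cmod (of_real a - w j)"
      using far[OF that] \<open>0 < q\<close> by (intro mult_left_mono) auto
    moreover have "cmod (of_real c - w j) < (1 - q / 2) * cmod (of_real a - w j)"
      unfolding q_def using c by (intro lune_dist_less[OF a] critical_in_lune that) auto
    ultimately show ?thesis using z unfolding q_def[symmetric] by (simp add: left_diff_distrib)
  qed
  then obtain y where y: "cmod y < 1"
    "of_nat n * poly P z = poly (pderiv P) (of_real a) * (z - of_real a) * (\<Sum>k<n. y ^ k)"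
    by (rule poly_P_eq_geometric_sum[OF zero_less_one])
  have "z \<noteq> of_real a"
  proof
    assume "z = of_real a"
    then have "a - c < q / 2" using z c by (simp add: q_def flip: of_real_diff)
    then show False using \<open>q < 1 * (a - c)\<close> c by simp
  qed
  moreover have "(\<Sum>k<n. y ^ k) \<noteq> 0"
  proof -
    have "0 < (1 - cmod y ^ n) / 2" using y(1) n_pos by (simp add: power_less_one_iff)
    also have "\<dots> \<le> cmod (\<Sum>k<n. y ^ k)" using y(1) by (intro norm_geometric_sum_ge) auto
    finally show ?thesis by auto
  qed
  moreover have "poly (pderiv P) (of_real a) \<noteq> 0"
    using cmod_poly_pderiv_a D_ge_1 n_pos by auto
  ultimately show ?thesis using y(2) by auto
qed

lemma cmod_poly_P_split:
  "cmod (poly P x) = cmod (x - of_real a) * (\<Prod>k=1..m. cmod (x - Z k))"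
proof -
  have "{..<n} = insert 0 {1..m}" by (auto simp: n)
  then show ?thesis by (simp add: cmod_poly_of_roots Z_0)
qed

end

section \<open>Counterexamples of large degree\<close>

locale sendov_large_counterexample = sendov_counterexample +
  assumes n_large: "32 * ln (40 / a\<^sup>2) \<le> real n * a\<^sup>2"
begin

lemma exp_degree_le: "exp (- (real n * a\<^sup>2 / 32)) \<le> a\<^sup>2 / 40"
proof -
  have "exp (- (real n * a\<^sup>2 / 32)) \<le> exp (- ln (40 / a\<^sup>2))" using n_large by simp
  also have "\<dots> = a\<^sup>2 / 40" using a by (simp add: exp_minus)
  finally show ?thesis .
qed

lemma cmod_poly_P_middle_ge:
  assumes x: "0 \<le> x" "x < a" and q: "a\<^sup>2 / 16 \<le> x * (a - x)"
  shows "D * (a - x) * (39 / 80) \<le> cmod (poly P (of_real x))"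
proof -
  have "x * (a - x) \<le> 1 * 1" using x a by (intro mult_mono) auto
  moreover have "1 - x * (a - x) / 2 \<le> exp (- (a\<^sup>2 / 32))"
    using q exp_ge_add_one_self[of "- (a\<^sup>2 / 32)"] by linarith
  ultimately have "(1 - x * (a - x) / 2) ^ n \<le> exp (- (a\<^sup>2 / 32)) ^ n"
    by (intro power_mono) auto
  also have "\<dots> = exp (- (real n * a\<^sup>2 / 32))" by (simp flip: exp_of_nat_mult)
  also have "\<dots> \<le> a\<^sup>2 / 40" by (rule exp_degree_le)
  also have "\<dots> \<le> 1 / 40" using a by (simp add: power_le_one)
  finally have "39 / 80 \<le> (1 - (1 - x * (a - x) / 2) ^ n) / 2" by simp
  then have "D * (a - x) * (39 / 80) \<le> D * (a - x) * ((1 - (1 - x * (a - x) / 2) ^ n) / 2)"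
    using x D_ge_1 by (intro mult_left_mono) auto
  also have "\<dots> \<le> cmod (poly P (of_real x))" by (rule cmod_poly_P_ge[OF x])
  finally show ?thesis .
qed

lemma sum_Re_zeros_le: "(\<Sum>k<n. Re (Z k)) \<le> real n * (a / 4)"
proof -
  have "exp (- (real n * a\<^sup>2 / 32)) \<le> a\<^sup>2 / 40" by (rule exp_degree_le)
  also have "\<dots> \<le> 1 * ((a - a / 4) * (39 / 80))"
    using a by (simp add: power2_eq_square)
  also have "\<dots> \<le> D * ((a - a / 4) * (39 / 80))"
    using D_ge_1 a by (intro mult_right_mono) auto
  also have "\<dots> \<le> cmod (poly P (of_real (a / 4)))"
    unfolding mult.assoc[symmetric]
    using a by (intro cmod_poly_P_middle_ge) (auto simp: power2_eq_square)
  finally have "2 * (a / 4) * (\<Sum>k<n. Re (Z k))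
      \<le> real (card {..<n}) * (a / 4)\<^sup>2 + 2 * (real n * a\<^sup>2 / 32)"
    using Z_disc by (intro sum_Re_le_of_prod_dist_ge) (auto simp: cmod_poly_of_roots)
  then have "a / 2 * (\<Sum>k<n. Re (Z k)) \<le> a / 2 * (real n * (a / 4))"
    by (simp add: power2_eq_square mult_ac)
  then show ?thesis using a by simp
qed

lemma sum_Re_critical_le: "(\<Sum>j<m. Re (w j)) \<le> real m * (a / 4)"
proof -
  have "real n * (\<Sum>j<m. Re (w j)) = Re (of_nat n * (\<Sum>j<m. w j))" by simp
  also have "\<dots> = real m * (\<Sum>k<n. Re (Z k))"
    using sum_roots_pderiv[OF pderiv[unfolded n]] by (simp add: n del: of_nat_Suc sum.lessThan_Suc)
  also have "\<dots> \<le> real m * (real n * (a / 4))"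
    using sum_Re_zeros_le by (intro mult_left_mono) auto
  finally have "real n * (\<Sum>j<m. Re (w j)) \<le> real n * (real m * (a / 4))" by (simp add: mult_ac)
  then show ?thesis using n_pos by simp
qed

lemma cmod_poly_pderiv_le:
  assumes t: "0 \<le> t" "t \<le> a / 2"
  shows "cmod (poly (pderiv P) (of_real t)) \<le> real n * D * exp (- (real m * a\<^sup>2 / 16))"
proof -
  let ?e = "\<lambda>j. - ((a - t) * (a + t - 2 * Re (w j))) / (2 * 2\<^sup>2)"
  have dist: "cmod (of_real t - w j) \<le> cmod (of_real a - w j) * exp (?e j)" if "j < m" for j
  proof (rule cmod_of_real_diff_le_mult_exp)
    have "Re (w j) < a / 2" "cmod (w j) \<le> 1"
      using lune_Re_less[OF a(1)] critical_in_lune[OF that] by (auto simp: lune_def)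
    then show "2 * Re (w j) \<le> a + t" "cmod (of_real a - w j) \<le> 2"
      using t a norm_triangle_ineq4[of "of_real a" "w j"] by simp_all
  qed (use t a in auto)
  have "(\<Sum>j<m. ?e j) = - ((a - t) / 8 * (real m * (a + t) - 2 * (\<Sum>j<m. Re (w j))))"
    by (simp add: sum_negf sum_subtractf flip: sum_distrib_left sum_divide_distrib)
  also have "\<dots> \<le> - ((a - t) / 8 * (real m * (a + t) - 2 * (real m * (a / 4))))"
    using sum_Re_critical_le t a by (intro le_imp_neg_le mult_left_mono diff_left_mono) simp_all
  also have "\<dots> = - (real m * (a\<^sup>2 / 16 + t * (a / 2 - t) / 8))"
    by (simp add: power2_eq_square field_simps)
  also have "\<dots> \<le> - (real m * (a\<^sup>2 / 16))"
    using t by (intro le_imp_neg_le mult_left_mono) auto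
  finally have exponent: "(\<Sum>j<m. ?e j) \<le> - (real m * a\<^sup>2 / 16)" by simp
  have "cmod (poly (pderiv P) (of_real t)) \<le> real n * (\<Prod>j<m. cmod (of_real a - w j) * exp (?e j))"
    unfolding cmod_poly_pderiv using dist by (intro mult_left_mono prod_mono) auto
  also have "\<dots> = real n * D * exp (\<Sum>j<m. ?e j)"
    by (simp add: D_def prod.distrib exp_sum)
  also have "\<dots> \<le> real n * D * exp (- (real m * a\<^sup>2 / 16))"
    using exponent D_ge_1 by (intro mult_left_mono) auto
  finally show ?thesis .
qed

lemma degree_mult_exp_le: "real n * exp (- (real m * a\<^sup>2 / 16)) \<le> 2 / 7"
proof -
  define v where "v = real n * a\<^sup>2 / 32"
  have a_sq: "0 < a\<^sup>2" "a\<^sup>2 \<le> 1" using a by (auto simp: power_le_one)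
  have exp_v: "exp (- v) \<le> a\<^sup>2 / 40" using exp_degree_le by (simp add: v_def)
  have "(exp (- (v / 2)))\<^sup>2 \<le> (1 / 6)\<^sup>2"
    using exp_v a_sq by (simp add: power2_eq_square flip: exp_add)
  then have "exp (- (v / 2)) \<le> 1 / 6" by (rule power2_le_imp_le) simp
  moreover have "v * exp (- v) \<le> 2 * exp (v / 2) * exp (- v)"
    using exp_ge_add_one_self[of "v / 2"] by (intro mult_right_mono, linarith) simp
  ultimately have v_exp: "v * exp (- v) \<le> 1 / 3" by (simp add: mult.assoc flip: exp_add)
  have "1 - a\<^sup>2 / 16 \<le> exp (- (a\<^sup>2 / 16))" using exp_ge_add_one_self[of "- (a\<^sup>2 / 16)"] by simp
  then have "15 / 16 \<le> exp (- (a\<^sup>2 / 16))" using a_sq by linarith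
  then have exp_a: "exp (a\<^sup>2 / 16) \<le> 16 / 15" by (simp add: exp_minus field_simps)
  have "real n * exp (- (real m * a\<^sup>2 / 16))
      = 32 / a\<^sup>2 * (v * exp (- v)) * exp (- v) * exp (a\<^sup>2 / 16)"
    using a_sq by (simp add: v_def n field_simps flip: exp_add)
  also have "\<dots> \<le> 32 / a\<^sup>2 * (1 / 3) * (a\<^sup>2 / 40) * (16 / 15)"
    using v_exp exp_v exp_a a_sq by (intro mult_mono) (auto simp: v_def)
  also have "\<dots> \<le> 2 / 7" using a_sq by simp
  finally show ?thesis .
qed

lemma cmod_poly_P_0_ge: "D * a / 10 \<le> cmod (poly P 0)"
proof -
  let ?S = "closed_segment 0 (complex_of_real (a / 2))"
  have "cmod (poly P (of_real (a / 2)) - poly P 0)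
      \<le> real n * D * exp (- (real m * a\<^sup>2 / 16)) * cmod (of_real (a / 2) - 0)"
  proof (rule field_differentiable_bound[of ?S "poly P" "poly (pderiv P)"])
    fix z assume "z \<in> ?S"
    then obtain u where u: "0 \<le> u" "u \<le> 1" "z = of_real (u * (a / 2))"
      by (auto simp: in_segment scaleR_conv_of_real)
    have "u * (a / 2) \<le> 1 * (a / 2)" using u a by (intro mult_right_mono) auto
    then show "cmod (poly (pderiv P) z) \<le> real n * D * exp (- (real m * a\<^sup>2 / 16))"
      unfolding u(3) using u a by (intro cmod_poly_pderiv_le) auto
  qed (auto intro: DERIV_subset[OF poly_DERIV])
  also have "\<dots> = D * (a / 2) * (real n * exp (- (real m * a\<^sup>2 / 16)))" using a by simp
  also have "\<dots> \<le> D * (a / 2) * (2 / 7)"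
    using degree_mult_exp_le a D_ge_1 by (intro mult_left_mono) auto
  finally have "cmod (poly P (of_real (a / 2)) - poly P 0) \<le> D * a * (1 / 7)" by simp
  moreover have "D * (a - a / 2) * (39 / 80) \<le> cmod (poly P (of_real (a / 2)))"
    using a by (intro cmod_poly_P_middle_ge) (auto simp: power2_eq_square)
  moreover have "cmod (poly P (of_real (a / 2))) - cmod (poly P 0)
      \<le> cmod (poly P (of_real (a / 2)) - poly P 0)"
    by (rule norm_triangle_ineq2)
  ultimately have "D * a * (39 / 160) - D * a * (1 / 7) \<le> cmod (poly P 0)"
    by (simp add: algebra_simps)
  moreover have "0 \<le> D * a" using a D_ge_1 by simp
  ultimately show ?thesis by linarith
qed

lemma prod_zeros_ge: "1 / 10 \<le> (\<Prod>k=1..m. cmod (Z k))"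
proof -
  have "1 * (a / 10) \<le> D * (a / 10)" using D_ge_1 a by (intro mult_right_mono) auto
  also have "\<dots> \<le> a * (\<Prod>k=1..m. cmod (Z k))"
    using cmod_poly_P_0_ge cmod_poly_P_split[of 0] a by simp
  finally show ?thesis using a by simp
qed

lemma D_le_10: "D \<le> 10"
proof -
  have "(\<Prod>k=1..m. cmod (Z k)) \<le> 1" using Z_disc by (intro prod_le_1) (auto simp: n)
  then have "cmod (poly P 0) \<le> a"
    using cmod_poly_P_split[of 0] a by (simp add: mult_le_cancel_left1)
  then have "a * (D / 10) \<le> a * 1" using cmod_poly_P_0_ge by (simp add: mult.commute)
  then show ?thesis using a by (simp add: mult_le_cancel_left)
qed

lemma cmod_prod_dist_zeros_le:
  assumes c: "0 < c" "c < a"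
  shows "(\<Prod>k=1..m. cmod (of_real c - Z k)) \<le> 20 / (c * (a - c))"
proof -
  have "cmod (of_real c - of_real a) = a - c" using c by (simp flip: of_real_diff)
  then have "(a - c) * (\<Prod>k=1..m. cmod (of_real c - Z k)) \<le> 2 * D / c"
    using cmod_poly_P_le[OF c] by (simp add: cmod_poly_P_split)
  also have "\<dots> \<le> 20 / c" using D_le_10 c by (intro divide_right_mono) auto
  finally show ?thesis using c by (simp add: pos_le_divide_eq mult_ac)
qed

section \<open>Comparison of the reflected products\<close>

lemma ln_prod_reflected_critical_ge:
  assumes c: "0 \<le> c" "c \<le> a"
  shows "real m * (ln (lune_corner a c) + lune_slope a c * (a / 4))
    \<le> ln (\<Prod>j<m. cmod (1 - of_real c * w j))"
proof -
  let ?A = "lune_slope a c" and ?s = "lune_corner a c"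
  have "real m * (ln ?s + ?A * (a / 4))
      = real m * ln ?s + ?A * (real m * (a / 2) - real m * (a / 4))"
    by (simp add: algebra_simps)
  also have "\<dots> \<le> real m * ln ?s + ?A * (real m * (a / 2) - (\<Sum>j<m. Re (w j)))"
    using sum_Re_critical_le lune_slope_nonneg[OF a c]
    by (intro add_left_mono mult_left_mono diff_left_mono)
  also have "\<dots> = (\<Sum>j<m. ln ?s + ?A * (a / 2 - Re (w j)))"
    by (simp add: sum.distrib sum_subtractf flip: sum_distrib_left)
  also have "\<dots> \<le> (\<Sum>j<m. ln (cmod (1 - of_real c * w j)))"
    using a c critical_in_lune by (intro sum_mono lune_ln_cmod_ge) auto
  also have "\<dots> = ln (\<Prod>j<m. cmod (1 - of_real c * w j))"
  proof (rule ln_prod[symmetric])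
    show "cmod (1 - of_real c * w j) \<noteq> 0" if "j \<in> {..<m}" for j
      using critical_in_lune[of j] cmod_one_minus_mult_pos[of c "w j"] that a c
      by (auto simp: lune_def)
  qed simp
  finally show ?thesis .
qed

lemma prod_reflected_critical_le:
  assumes c: "0 < c" "c < 1"
  shows "(\<Prod>j<m. cmod (1 - of_real c * w j))
    \<le> (1 - a * c) / (1 - c) * (\<Prod>k=1..m. cmod (1 - of_real c * Z k))"
proof -
  let ?R = "\<Prod>k<n. cmod (1 - of_real c * Z k)"
  have factor_ge: "1 - c \<le> cmod (1 - of_real c * Z k)" if "k < n" for k
    using c Z_disc[OF that] by (intro cmod_one_minus_mult_ge) auto
  have "of_nat n * (\<Prod>j<m. 1 - of_real c * w j)
      = (\<Prod>k<n. 1 - of_real c * Z k) * (\<Sum>k<n. 1 / (1 - of_real c * Z k))"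
    unfolding n using c factor_ge
    by (intro prod_reflected_pderiv[OF pderiv[unfolded n]]) (force simp: n)+
  from arg_cong[OF this, of cmod] have "real n * (\<Prod>j<m. cmod (1 - of_real c * w j))
      = ?R * cmod (\<Sum>k<n. 1 / (1 - of_real c * Z k))"
    by (simp add: norm_mult prod_norm)
  also have "cmod (\<Sum>k<n. 1 / (1 - of_real c * Z k)) \<le> real (card {..<n}) * (1 / (1 - c))"
    using factor_ge c by (intro sum_norm_bound) (simp add: norm_divide frac_le)
  then have "?R * cmod (\<Sum>k<n. 1 / (1 - of_real c * Z k)) \<le> ?R * (real n * (1 / (1 - c)))"
    by (intro mult_left_mono prod_nonneg) auto
  finally have "real n * (\<Prod>j<m. cmod (1 - of_real c * w j)) \<le> real n * (?R / (1 - c))"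
    by (simp add: mult.commute)
  then have "(\<Prod>j<m. cmod (1 - of_real c * w j)) \<le> ?R / (1 - c)"
    using n_pos by (simp only: mult_le_cancel_left_pos of_nat_0_less_iff)
  moreover have "?R = (1 - a * c) * (\<Prod>k=1..m. cmod (1 - of_real c * Z k))"
  proof -
    have "a * c < 1 * 1" using a c by (intro mult_strict_mono) auto
    moreover have "1 - complex_of_real c * of_real a = of_real (1 - a * c)"
      by (simp add: mult.commute)
    ultimately have "cmod (1 - of_real c * of_real a) = 1 - a * c" by (simp only: norm_of_real)
    moreover have "{..<n} = insert 0 {1..m}" by (auto simp: n)
    ultimately show ?thesis by (simp add: Z_0)
  qed
  ultimately show ?thesis by simp
qed

lemma prod_reflected_zeros_le:
  assumes c: "0 < c" "c < a" and r: "0 < r" "r < 1" "r * (1 - c\<^sup>2) = c * (a - c) / 2"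
    and \<kappa>: "0 \<le> \<kappa>" "((c + r) / (1 + c * r)) powr \<kappa> \<le> r / (1 + c * r)"
  shows "(\<Prod>k=1..m. cmod (1 - of_real c * Z k)) \<le> 20 / (c * (a - c)) * 10 powr \<kappa>"
proof -
  let ?Q = "\<Prod>k=1..m. cmod (1 - of_real c * Z k)"
  have "c < 1" using c a by simp
  have "0 < cmod (1 - of_real c * Z k)" if "k \<in> {1..m}" for k
    using Z_disc[of k] that c \<open>c < 1\<close> by (intro cmod_one_minus_mult_pos) (simp_all add: n)
  then have "0 < ?Q" by (rule prod_pos)
  have blaschke: "cmod (Z k) powr \<kappa> \<le> cmod (of_real c - Z k) / cmod (1 - of_real c * Z k)"
    if "k \<in> {1..m}" for k
  proof -
    have "k < n" using that by (simp add: n)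
    then have "poly P (Z k) = 0" by (auto simp: poly_poly_of_roots_eq_0_iff)
    then have "r * (1 - c\<^sup>2) \<le> cmod (Z k - of_real c)"
      unfolding r(3) using poly_P_neq_0_near[OF c, of "Z k"] by force
    with powr_le_cmod_blaschke[OF c(1) \<open>c < 1\<close> r(1,2) \<kappa> Z_disc[OF \<open>k < n\<close>]]
    show ?thesis by (simp add: norm_minus_commute)
  qed
  have "(1 / 10) powr \<kappa> \<le> (\<Prod>k=1..m. cmod (Z k)) powr \<kappa>"
    using prod_zeros_ge \<kappa>(1) by (intro powr_mono2) auto
  also have "\<dots> = (\<Prod>k=1..m. cmod (Z k) powr \<kappa>)" by (rule prod_powr_distrib)
  also have "\<dots> \<le> (\<Prod>k=1..m. cmod (of_real c - Z k) / cmod (1 - of_real c * Z k))"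
    using blaschke by (intro prod_mono) auto
  also have "\<dots> = (\<Prod>k=1..m. cmod (of_real c - Z k)) / ?Q" by (rule prod_dividef)
  finally have "(1 / 10) powr \<kappa> * ?Q \<le> (\<Prod>k=1..m. cmod (of_real c - Z k))"
    using \<open>0 < ?Q\<close> by (simp add: pos_le_divide_eq)
  also have "\<dots> \<le> 20 / (c * (a - c))" by (rule cmod_prod_dist_zeros_le[OF c])
  finally have "?Q / 10 powr \<kappa> \<le> 20 / (c * (a - c))" by (simp add: powr_divide)
  then show ?thesis by (simp add: pos_divide_le_eq)
qed

lemma degree_mult_ln_le:
  assumes c: "0 < c" "c < a" and r: "0 < r" "r < 1" "r * (1 - c\<^sup>2) = c * (a - c) / 2"
    and \<kappa>: "0 \<le> \<kappa>" "((c + r) / (1 + c * r)) powr \<kappa> \<le> r / (1 + c * r)"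
  shows "real m * (ln (lune_corner a c) + lune_slope a c * (a / 4))
    \<le> ln ((1 - a * c) / (1 - c)) + ln (20 / (c * (a - c))) + \<kappa> * ln 10"
proof -
  let ?W = "\<Prod>j<m. cmod (1 - of_real c * w j)"
  have "c < 1" using c a by simp
  have "a * c < 1 * 1" using a c by (intro mult_strict_mono) auto
  then have pos: "0 < (1 - a * c) / (1 - c)" "0 < 20 / (c * (a - c))" using c \<open>c < 1\<close> by auto
  have "0 < cmod (1 - of_real c * w j)" if "j \<in> {..<m}" for j
    using critical_in_lune[of j] that c \<open>c < 1\<close>
    by (intro cmod_one_minus_mult_pos) (simp_all add: lune_def)
  then have "0 < ?W" by (rule prod_pos)
  have "?W \<le> (1 - a * c) / (1 - c) * (\<Prod>k=1..m. cmod (1 - of_real c * Z k))"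
    using c(1) \<open>c < 1\<close> by (rule prod_reflected_critical_le)
  also have "\<dots> \<le> (1 - a * c) / (1 - c) * (20 / (c * (a - c)) * 10 powr \<kappa>)"
    using pos(1) by (intro mult_left_mono prod_reflected_zeros_le[OF c r \<kappa>]) auto
  finally have "ln ?W \<le> ln ((1 - a * c) / (1 - c) * (20 / (c * (a - c)) * 10 powr \<kappa>))"
    using \<open>0 < ?W\<close> by (rule ln_mono)
  also have "\<dots> = ln ((1 - a * c) / (1 - c)) + (ln (20 / (c * (a - c))) + \<kappa> * ln 10)"
    using pos by (subst ln_mult_pos, simp, simp, subst ln_mult_pos) (simp_all add: ln_powr)
  finally show ?thesis
    using ln_prod_reflected_critical_ge[of c] c by simp
qed

end

section \<open>The parameters of the theorem\<close>

lemma cc_bounds: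
  assumes a: "0 < a" "a < 1"
  shows "0 < cc a" "9 / 10 * a < cc a" "cc a < a" "a - cc a = a * (1 - a) / 10"
proof -
  show diff: "a - cc a = a * (1 - a) / 10"
    by (simp add: cc_def gam_def algebra_simps)
  have "0 < a * (1 - a)" "a * (1 - a) < a * 1" using a by (auto intro!: mult_strict_left_mono)
  then show "cc a < a" "9 / 10 * a < cc a" using diff by (auto simp: algebra_simps)
  then show "0 < cc a" using a by linarith
qed

lemma rr_bounds:
  assumes a: "0 < a" "a < 1"
  shows "0 < rr a" "40 * rr a \<le> cc a" "rr a * (1 - (cc a)\<^sup>2) = cc a * (a - cc a) / 2"
proof -
  define c where "c = cc a"
  have c: "0 < c" "c < a" "a - c = a * (1 - a) / 10" using cc_bounds[OF a] by (auto simp: c_def)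
  have "c\<^sup>2 \<le> a\<^sup>2" using c by (intro power_mono) auto
  moreover have "a\<^sup>2 < 1" using a by (simp add: power_less_one_iff)
  ultimately have pos: "0 < 1 - c\<^sup>2" by linarith
  have rr: "rr a = c * (a - c) / (2 * (1 - c\<^sup>2))" by (simp add: rr_def c_def)
  show "0 < rr a" unfolding rr using c pos by simp
  show "rr a * (1 - (cc a)\<^sup>2) = cc a * (a - cc a) / 2"
    using pos unfolding rr c_def by (simp add: field_simps)
  then have "40 * rr a * (1 - c\<^sup>2) = 40 * (c * (a - c) / 2)"
    by (simp only: mult.assoc c_def)
  also have "\<dots> = c * (2 * a * (1 - a))" by (simp add: c(3))
  also have "\<dots> \<le> c * (1 - c\<^sup>2)"
  proof (intro mult_left_mono)
    have "2 * a * (1 - a) \<le> (1 + a) * (1 - a)" using a by (intro mult_right_mono) auto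
    then show "2 * a * (1 - a) \<le> 1 - c\<^sup>2"
      using \<open>c\<^sup>2 \<le> a\<^sup>2\<close> by (simp add: power2_eq_square algebra_simps)
  qed (use c in simp)
  finally show "40 * rr a \<le> cc a" using pos by (simp add: c_def)
qed

text \<open>Bounding the product of the zeros by \<open>1 / 10\<close> instead of \<open>a / 16\<close> leaves room for the factor
  \<open>1 + c r\<close> in the exponent.\<close>

lemma exponent_mult_ln_10_le:
  assumes a: "0 < a" "a < 1"
  defines "\<rho> \<equiv> (cc a + rr a) / (1 + cc a * rr a)"
  shows "ln (rr a / (1 + cc a * rr a)) / ln \<rho> * ln 10 \<le> ln (rr a) - alpha a * ln (rr a)"
proof -
  define c r where "c = cc a" and "r = rr a"
  have c: "0 < c" "c < 1" "9 / 10 * a < c" and r: "0 < r" "r \<le> 1 / 40"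
    using cc_bounds[OF a] rr_bounds[OF a] a by (auto simp: c_def r_def)
  have \<rho>: "c < \<rho>" "\<rho> < 1" unfolding \<rho>_def c_def[symmetric] r_def[symmetric]
    using hyperbolic_shift(1,2)[OF c(1,2) r(1)] r by auto
  have "ln r \<le> - (39 / 40)" using ln_le_minus_one[OF r(1)] r(2) by linarith
  have "c * r \<le> r" "0 \<le> c * r" using c r by (simp_all add: mult_left_le_one_le)
  then have "ln (1 + c * r) \<le> 1 / 40"
    using ln_add_one_self_le_self[of "c * r"] r(2) by linarith
  then have "ln (1 + c * r) \<le> - ln r / 39" using \<open>ln r \<le> - (39 / 40)\<close> by linarith
  then have "(ln (1 + c * r) - ln r) * ln 10 \<le> (- ln r / 39 - ln r) * ln 10"
    by (intro mult_right_mono) auto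
  also have "\<dots> = - ln r * (ln 10 + ln 10 / 39)" by (simp add: algebra_simps)
  also have "\<dots> \<le> - ln r * ln (16 * \<rho> / a)"
  proof (intro mult_left_mono)
    have "ln 10 \<le> (9 :: real)" using ln_le_minus_one[of 10] by simp
    moreover have "11 / 36 \<le> ln (36 / 25 :: real)" using ln_add1_ge[of "11 / 25"] by simp
    moreover have "ln (10 * (36 / 25)) = ln 10 + ln (36 / 25 :: real)" by (rule ln_mult_pos) auto
    moreover have "ln (10 * (36 / 25)) \<le> ln (16 * \<rho> / a)"
      using a c \<rho> by (intro ln_mono) (simp_all add: le_divide_eq)
    ultimately show "ln 10 + ln 10 / 39 \<le> ln (16 * \<rho> / a)" by linarith
  qed (use \<open>ln r \<le> - (39 / 40)\<close> in simp)
  also have "ln (16 * \<rho> / a) = ln \<rho> - ln (a / 16)"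
    using a c \<rho> by (simp add: ln_div ln_mult_pos)
  also have "ln (a / 16) = alpha a * ln \<rho>"
    using c \<rho> by (simp add: alpha_def \<rho>_def[symmetric])
  finally have "(ln r - alpha a * ln r) * ln \<rho> \<le> (ln r - ln (1 + c * r)) * ln 10"
    by (simp add: algebra_simps)
  then have "(ln r - ln (1 + c * r)) * ln 10 / ln \<rho> \<le> ln r - alpha a * ln r"
    using c \<rho> by (simp add: neg_divide_le_eq)
  moreover have "ln (r / (1 + c * r)) = ln r - ln (1 + c * r)"
    using c r by (simp add: ln_divide_pos add_pos_pos)
  ultimately show ?thesis by (simp flip: c_def r_def)
qed

lemma ln_KK:
  assumes a: "0 < a" "a < 1"
  shows "ln (KK a) = ln (lune_corner a (cc a)) + lune_slope a (cc a) * (a / 4)"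
proof -
  define c s where "c = cc a" and "s = lune_corner a c"
  let ?K = "\<lambda>u p. u powr p * s powr (1 - p)"
  have c: "0 < c" "c < a" using cc_bounds[OF a] by (auto simp: c_def)
  have "a * c < 1 * 1" using a c by (intro mult_strict_mono) auto
  then have "0 < s" "0 < 1 + c - a * c" using lune_corner_pos[of a c] c by (auto simp: s_def)
  then have pos: "0 < ?K (1 + c - a * c) (pp a)" "0 < ?K (1 + c) (qq a)" using c by simp_all
  have ln_K: "ln (?K u p) = ln s + p * (ln u - ln s)" if "0 < u" for u p
    using that \<open>0 < s\<close> by (simp add: ln_mult_pos ln_powr algebra_simps)
  define A B where "A = (ln (1 + c - a * c) - ln s) / (1 - a / 2)"
    and "B = (ln (1 + c) - ln s) / (1 + a / 2)"
  have weights: "pp a * (ln (1 + c - a * c) - ln s) = A * (a / 4)"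
    "qq a * (ln (1 + c) - ln s) = B * (a / 4)"
    by (simp_all add: A_def B_def pp_def qq_def mult.commute)
  have "KK a = min (?K (1 + c - a * c) (pp a)) (?K (1 + c) (qq a))"
    by (simp add: KK_def Let_def c_def s_def lune_corner_def)
  then have "ln (KK a) = min (ln (?K (1 + c - a * c) (pp a))) (ln (?K (1 + c) (qq a)))"
    using pos by (simp add: min_def)
  also have "\<dots> = min (ln s + A * (a / 4)) (ln s + B * (a / 4))"
    using c \<open>0 < 1 + c - a * c\<close> weights by (simp add: ln_K)
  also have "\<dots> = ln s + min A B * (a / 4)" using a by (simp add: min_def)
  finally show ?thesis by (simp add: A_def B_def c_def s_def lune_slope_def)
qed

lemma ln_KK_pos:
  assumes a: "0 < a" "a < 1"
  shows "0 < ln (KK a)"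
proof -
  define c s y where "c = cc a" and "s = lune_corner a c" and "y = c * (1 - a)"
  have c: "0 < c" "c < a" "a - c = a * (1 - a) / 10" using cc_bounds[OF a] by (auto simp: c_def)
  have y: "0 < y" "y < 1" using a c mult_strict_mono[of c 1 "1 - a" 1] by (simp_all add: y_def)
  have corner_gap: "a * y / 10 = c * (a - c)" unfolding y_def c(3) by simp
  have ln_s: "- (a * y / 10) \<le> ln s" "ln s \<le> 0"
    unfolding corner_gap s_def using a c by (intro ln_lune_corner_bounds; simp)+
  have chord: "- ln s < (ln u - ln s) / d * (a / 4)" if "0 < d" "d * y / 2 \<le> ln u" for u d
  proof -
    have "a * y / 10 < a / 4 * (y / 2)" using a y by simp
    also have "y / 2 \<le> ln u / d" using that by (simp add: pos_le_divide_eq mult.commute)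
    also have "ln u / d \<le> (ln u - ln s) / d" using that(1) ln_s by (intro divide_right_mono) auto
    finally show ?thesis using a ln_s(1) by (simp add: mult.commute mult_left_mono)
  qed
  have "(1 - a / 2) * y / 2 \<le> y / 2" using a y by (simp add: mult_left_le_one_le)
  also have "y / 2 \<le> ln (1 + y)" using y by (intro ln_one_plus_ge_half) auto
  also have "1 + y = 1 + c - a * c" by (simp add: y_def algebra_simps)
  finally have "- ln s < (ln (1 + c - a * c) - ln s) / (1 - a / 2) * (a / 4)"
    using a by (intro chord) auto
  moreover have "(1 + a / 2) * y / 2 \<le> ln (1 + c)"
  proof -
    have "(1 + a / 2) * (1 - a) \<le> 1" using a by (simp add: algebra_simps)
    then have "c * ((1 + a / 2) * (1 - a)) / 2 \<le> c / 2" using c by (simp add: mult_left_le)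
    also have "\<dots> \<le> ln (1 + c)" using a c by (intro ln_one_plus_ge_half) auto
    finally show ?thesis by (simp add: y_def mult_ac)
  qed
  then have "- ln s < (ln (1 + c) - ln s) / (1 + a / 2) * (a / 4)"
    using a by (intro chord) auto
  ultimately have "- ln s < lune_slope a c * (a / 4)"
    unfolding lune_slope_def s_def min_def by presburger
  then show ?thesis by (simp add: ln_KK[OF a] c_def s_def)
qed

context sendov_large_counterexample
begin

lemma degree_le_N3: "real n \<le> N3 a"
proof -
  define c r where "c = cc a" and "r = rr a"
  define \<rho> \<mu> where "\<rho> = (c + r) / (1 + c * r)" and "\<mu> = r / (1 + c * r)"
  define \<kappa> where "\<kappa> = ln \<mu> / ln \<rho>"
  have c: "0 < c" "c < a" using cc_bounds[OF a] by (auto simp: c_def)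
  have r: "0 < r" "40 * r \<le> c" "r * (1 - c\<^sup>2) = c * (a - c) / 2"
    using rr_bounds[OF a] by (auto simp: c_def r_def)
  have "r < 1" "c < 1" using r(2) c a by linarith+
  have \<rho>: "c < \<rho>" "\<rho> < 1"
    using hyperbolic_shift(1,2)[OF c(1) \<open>c < 1\<close> r(1) \<open>r < 1\<close>] by (auto simp: \<rho>_def)
  have "0 < c * r" using c r(1) by simp
  then have \<mu>: "0 < \<mu>" "\<mu> < 1" using r(1) \<open>r < 1\<close> by (simp_all add: \<mu>_def divide_less_eq)
  have "0 \<le> \<kappa>" unfolding \<kappa>_def using \<rho> \<mu> c(1) by (intro divide_nonpos_neg) auto
  moreover have "\<rho> powr \<kappa> \<le> \<mu>" using \<rho> \<mu> c(1) by (simp add: \<kappa>_def powr_def)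
  ultimately have \<kappa>: "0 \<le> \<kappa>" "((c + r) / (1 + c * r)) powr \<kappa> \<le> r / (1 + c * r)"
    by (simp_all only: \<rho>_def \<mu>_def)
  have "real m * ln (KK a) \<le> ln ((1 - a * c) / (1 - c)) + ln (20 / (c * (a - c))) + \<kappa> * ln 10"
    unfolding ln_KK[OF a] c_def[symmetric] by (rule degree_mult_ln_le[OF c r(1) \<open>r < 1\<close> r(3) \<kappa>])
  moreover have "\<kappa> * ln 10 \<le> ln r - alpha a * ln r"
    unfolding \<kappa>_def \<mu>_def \<rho>_def c_def r_def by (rule exponent_mult_ln_10_le[OF a])
  moreover have "ln (20 / (c * (a - c))) + ln r \<le> ln ((1 + a) / (a - c))"
  proof -
    have "ln (20 / (c * (a - c))) + ln r = ln (20 / (c * (a - c)) * r)"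
      using c r(1) by (intro ln_mult_pos[symmetric]) auto
    also have "20 / (c * (a - c)) * r = 20 * r / c / (a - c)" by simp
    also have "20 * r / c \<le> 1" using c r by (simp add: divide_le_eq)
    with a have "20 * r / c \<le> 1 + a" by linarith
    then have "ln (20 * r / c / (a - c)) \<le> ln ((1 + a) / (a - c))"
      using c r(1) a by (intro ln_mono divide_right_mono) auto
    finally show ?thesis .
  qed
  ultimately have "real m * ln (KK a)
      \<le> ln ((1 + a) / (a - c)) + ln ((1 - a * c) / (1 - c)) - alpha a * ln r"
    by linarith
  then have "real m
      \<le> (ln ((1 + a) / (a - c)) + ln ((1 - a * c) / (1 - c)) - alpha a * ln r) / ln (KK a)"
    using ln_KK_pos[OF a] by (simp add: pos_le_divide_eq)
  then show ?thesis by (simp add: N3_def Let_def c_def r_def n)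
qed

end

section \<open>Critical points near a zero\<close>

lemma mult_poly_of_roots_eq:
  "[:- x, 1:] * (\<Prod>j=1..m. [:- z j, 1:]) = poly_of_roots (Suc m) (z(0 := x))"
proof -
  have "{..<Suc m} = insert 0 {1..m}" by auto
  then show ?thesis by (simp add: poly_of_roots_def)
qed

lemma ex_critical_point_near_root:
  fixes a :: real and Z :: "nat \<Rightarrow> complex"
  assumes a: "0 < a" "a < 1" and n: "n = Suc m"
    and Z: "Z 0 = of_real a" "\<And>k. k < n \<Longrightarrow> cmod (Z k) \<le> 1"
    and large: "N0 a \<le> real n" "N3 a < real n"
  shows "\<exists>w. cmod (w - of_real a) \<le> 1 \<and> poly (pderiv (poly_of_roots n Z)) w = 0"
proof (rule ccontr)
  assume no_critical: "\<not> ?thesis"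
  obtain w where w: "pderiv (poly_of_roots n Z) = smult (of_nat n) (poly_of_roots m w)"
    unfolding n by (rule pderiv_poly_of_roots_eq)
  have "sendov_large_counterexample a n m Z w"
  proof
    show "1 < cmod (of_real a - w j)" if "j < m" for j
    proof -
      have "poly (pderiv (poly_of_roots n Z)) (w j) = 0"
        using that by (auto simp: w poly_poly_of_roots_eq_0_iff)
      then show ?thesis using no_critical by (force simp: norm_minus_commute)
    qed
    show "32 * ln (40 / a\<^sup>2) \<le> real n * a\<^sup>2"
      using large(1) a by (simp add: N0_def pos_divide_le_eq)
  qed (use a n Z w in auto)
  then have "real n \<le> N3 a" by (rule sendov_large_counterexample.degree_le_N3)
  then show False using large(2) by simp
qed

theorem mainTheorem12:
  fixes a :: real and n :: nat and z :: "nat \<Rightarrow> complex" and P :: "complex poly"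
  assumes "0 < a" "a < 1" "n \<ge> 2"
    and "\<And>j. j \<in> {1..n-1} \<Longrightarrow> cmod (z j) \<le> 1"
    and "P = [:- complex_of_real a, 1:] * (\<Prod>j=1..n-1. [:- z j, 1:])"
    and "real n > max (N1 a) (max (N2 a (cc a)) (N3 a))"
  shows "\<exists>w. cmod (w - complex_of_real a) \<le> 1 \<and> poly (pderiv P) w = 0"
proof -
  define Z where "Z = z(0 := complex_of_real a)"
  have n: "n = Suc (n - 1)" using assms(3) by simp
  have "P = poly_of_roots n Z"
    using mult_poly_of_roots_eq[of "complex_of_real a" z "n - 1"] n by (simp add: assms(5) Z_def)
  moreover have "cmod (Z k) \<le> 1" if "k < n" for k
    using that assms(1,2) assms(4)[of k] by (auto simp: Z_def)
  moreover have "N0 a \<le> real n" "N3 a < real n" using assms(6) by (simp_all add: N1_def)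
  ultimately show ?thesis
    using ex_critical_point_near_root[OF assms(1,2) n] by (simp add: Z_def)
qed

end
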